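(* Let $d,p,q,m,k$ be positive integers, let $\Omega=\Omega_1\times\cdots\times\Omega_d$ with each $\Omega_i\subset\mathbb R$ a bounded interval, and let $\Psi(x)=\sum_{j=1}^p\prod_{i=1}^d\phi_{i,j}(x_i)$ be a tensor neural network on $\Omega$ whose activation functions are smooth enough that $\Psi$ has partial derivatives up to order $m$. Let $$F(x)=\sum_{\alpha\in\mathcal A}A_\alpha(x)\prod_{\beta\in\mathcal B}\left(\frac{\partial^{|\beta|}\Psi(x)}{\partial x_1^{\beta_1}\cdots\partial x_d^{\beta_d}}\right)^{\alpha_\beta},\qquad A_\alpha(x)=\sum_{\ell=1}^q B_{1,\ell,\alpha}(x_1)\cdots B_{d,\ell,\alpha}(x_d),$$ where $B_{i,\ell,\alpha}\in L^2(\Omega_i)$. For each $i$ let $\{x_i^{(n_i)}\}_{n_i=1}^{N_i}$ and $\{w_i^{(n_i)}\}_{n_i=1}^{N_i}$ be $N_i$ Gauss points and the corresponding weights on $\Omega_i$, and put $N=\max\{N_1,\dots,N_d\}$, $\underline N=\min\{N_1,\dots,N_d\}$. Consider the two quadrature schemes for $\int_\Omega F(x)\,dx$: (direct scheme) $$Q_1=\sum_{n\in\mathcal N}w^{(n)}\sum_{\alpha\in\mathcal A}\left(\sum_{\ell=1}^q B_{1,\ell,\alpha}(x_1^{(n_1)})\cdots B_{d,\ell,\alpha}(x_d^{(n_d)})\right)\prod_{\beta\in\mathcal B_\alpha}\left(\frac{\partial^{|\beta|}\Psi(x^{(n)})}{\partial x_1^{\beta_1}\cdots\partial x_d^{\beta_d}}\right)^{\alpha_\beta},$$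 (splitting scheme) $$Q_2=\sum_{\alpha\in\mathcal A}\sum_{\ell=1}^q\ \sum_{\substack{1\le j_{\beta,r}\le p\\ \beta\in\mathcal B_\alpha,\ r=1,\dots,\alpha_\beta}}\ \prod_{i=1}^d\left(\sum_{n_i=1}^{N_i}w_i^{(n_i)}B_{i,\ell,\alpha}(x_i^{(n_i)})\prod_{\beta\in\mathcal B_\alpha}\prod_{r=1}^{\alpha_\beta}\frac{\partial^{\beta_i}\phi_{i,j_{\beta,r}}(x_i^{(n_i)})}{\partial x_i^{\beta_i}}\right).$$ Then the splitting scheme is equivalent to the direct scheme (that is, $Q_2=Q_1$) and has $2\underline N$-th order accuracy. Moreover, if $T_1$ denotes the computational complexity of a one-dimensional function evaluation operation, then the computational complexity of evaluating the splitting scheme $Q_2$ is bounded by $$\mathcal O\big(d\,q\,T_1\,k^2\,p^k\,\big((d+m)^m+k\big)^k\,N\big),$$ which is of polynomial scale in the dimension $d$.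
   Context: Multi-index sets, with $\mathbb N_0$ the non-negative integers: $\mathcal B=\{\beta=(\beta_1,\dots,\beta_d)\in\mathbb N_0^d:\ |\beta|:=\sum_{i=1}^d\beta_i\le m\}$; $\mathcal A=\{\alpha=(\alpha_\beta)_{\beta\in\mathcal B}\in\mathbb N_0^{|\mathcal B|}:\ |\alpha|:=\sum_{\beta\in\mathcal B}\alpha_\beta\le k\}$; and for $\alpha\in\mathcal A$, $\mathcal B_\alpha=\{\beta\in\mathcal B:\ \alpha_\beta\ge 1\}$. Here $|\mathcal B|$ is the cardinality of $\mathcal B$. The paper focuses on the high-dimensional case $m\ll d$, $k\ll d$. Quadrature indices: $\mathcal N=\{1,\dots,N_1\}\times\cdots\times\{1,\dots,N_d\}$; for $n=(n_1,\dots,n_d)\in\mathcal N$, $x^{(n)}=(x_1^{(n_1)},\dots,x_d^{(n_d)})$ and $w^{(n)}=w_1^{(n_1)}\cdots w_d^{(n_d)}$. Tensor neural network (TNN): for $i=1,\dots,d$ the $i$-th subnetwork is a feed-forward fully connected neural network with one-dimensional input $x_i\in\Omega_i$ and $p$-dimensional output $(\phi_{i,1}(x_i),\dots,\phi_{i,p}(x_i))^T$ (dependence on the parameters is suppressed in the notation); the TNN is $\Psi(x)=\sum_{j=1}^p\prod_{i=1}^d\phi_{i,j}(x_i)$. Complexity: $T_1$ is the cost of a one-dimensional function evaluation operation (evaluation at a point of the one-dimensional functions appearing in the scheme, i.e. the $B_{i,\ell,\alpha}$ and the $\phi_{i,j}$ and their derivatives). Accuracy: one-dimensional integration with $N_i$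 Gauss points has $2N_i$-th order accuracy. The order is understood in the usual sense: when each $\Omega_i$ is decomposed into subintervals of mesh size $h$ and the $N_i$ Gauss points are used on each subinterval, the resulting $d$-dimensional quadrature of $F$ has error $\mathcal O(h^{2\underline N}/(2\underline N)!)$, with a constant depending on the smoothness of $F$. *)

theory Defs
  imports "HOL-Analysis.Analysis" "HOL-Computational_Algebra.Polynomial"
begin

section \<open>Multi-index sets\<close>

text \<open>The dimension \<open>d\<close> varies inside the statement, so points of \<open>d\<close>-space, multi-indices and the
  families indexed by them are extensional functions (\<open>undefined\<close> off the index set).
  In particular a family indexed by multi-indices is a function on \<open>nat \<Rightarrow> nat\<close>.\<close>

definition idx_B :: "nat \<Rightarrow> nat \<Rightarrow> (nat \<Rightarrow> nat) set" where
  "idx_B d m = {\<beta> \<in> {1..d} \<rightarrow>\<^sub>E UNIV. (\<Sum>i=1..d. \<beta> i) \<le> m}"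

definition idx_A :: "nat \<Rightarrow> nat \<Rightarrow> nat \<Rightarrow> ((nat \<Rightarrow> nat) \<Rightarrow> nat) set" where
  "idx_A d m k = {\<alpha> \<in> idx_B d m \<rightarrow>\<^sub>E UNIV. (\<Sum>\<beta>\<in>idx_B d m. \<alpha> \<beta>) \<le> k}"

definition idx_B_of :: "nat \<Rightarrow> nat \<Rightarrow> ((nat \<Rightarrow> nat) \<Rightarrow> nat) \<Rightarrow> (nat \<Rightarrow> nat) set" where
  "idx_B_of d m \<alpha> = {\<beta> \<in> idx_B d m. \<alpha> \<beta> \<ge> 1}"

text \<open>The index tuples \<open>(j\<^bsub>\<beta>,r\<^esub>)\<close> with entries in \<open>{1..p}\<close>.\<close>

definition idx_J :: "nat \<Rightarrow> nat \<Rightarrow> nat \<Rightarrow> ((nat \<Rightarrow> nat) \<Rightarrow> nat) \<Rightarrow> ((nat \<Rightarrow> nat) \<times> nat \<Rightarrow> nat) set" where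
  "idx_J d m p \<alpha> = (SIGMA \<beta>:idx_B_of d m \<alpha>. {1..\<alpha> \<beta>}) \<rightarrow>\<^sub>E {1..p}"


section \<open>Partial derivatives\<close>

definition part_deriv :: "nat \<Rightarrow> ((nat \<Rightarrow> real) \<Rightarrow> real) \<Rightarrow> (nat \<Rightarrow> real) \<Rightarrow> real" where
  "part_deriv i f = (\<lambda>x. deriv (\<lambda>t. f (x(i := t))) (x i))"

text \<open>\<open>\<partial>\<^sub>1\<close> is applied last, \<open>\<partial>\<^sub>d\<close> first, as in the written order of the symbol.\<close>

definition multi_deriv :: "nat \<Rightarrow> (nat \<Rightarrow> nat) \<Rightarrow> ((nat \<Rightarrow> real) \<Rightarrow> real) \<Rightarrow> (nat \<Rightarrow> real) \<Rightarrow> real" where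
  "multi_deriv d \<beta> f = foldr (\<lambda>i. part_deriv i ^^ \<beta> i) [1..<Suc d] f"

definition times_differentiable :: "nat \<Rightarrow> (real \<Rightarrow> real) \<Rightarrow> bool" where
  "times_differentiable m f \<longleftrightarrow> (\<forall>r<m. \<forall>t. (deriv ^^ r) f field_differentiable (at t))"

text \<open>\<open>f\<close> has continuous and bounded partial derivatives (in any order of the variables) up to
  order \<open>r\<close> on \<open>U\<close>, an open box. This covers every \<open>f\<close> that is \<open>C\<^sup>r\<close> up to the boundary.\<close>

primrec C_bounded :: "nat \<Rightarrow> (nat \<Rightarrow> real) set \<Rightarrow> nat \<Rightarrow> ((nat \<Rightarrow> real) \<Rightarrow> real) \<Rightarrow> bool" where
  "C_bounded d U 0 f \<longleftrightarrow> continuous_on U f \<and> bounded (f ` U)"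
| "C_bounded d U (Suc r) f \<longleftrightarrow> continuous_on U f \<and> bounded (f ` U) \<and>
     (\<forall>i\<in>{1..d}. (\<forall>x\<in>U. (\<lambda>t. f (x(i := t))) field_differentiable (at (x i))) \<and>
        C_bounded d U r (part_deriv i f))"


section \<open>Tensor neural networks\<close>

record layer =
  layer_width :: nat
  layer_weight :: "nat \<Rightarrow> nat \<Rightarrow> real"
  layer_bias :: "nat \<Rightarrow> real"
  layer_act :: "real \<Rightarrow> real"

definition layer_map :: "nat \<Rightarrow> layer \<Rightarrow> (nat \<Rightarrow> real) \<Rightarrow> nat \<Rightarrow> real" where
  "layer_map n_in L v =
     (\<lambda>r. layer_act L ((\<Sum>c=1..n_in. layer_weight L r c * v c) + layer_bias L r))"

primrec fnn :: "nat \<Rightarrow> layer list \<Rightarrow> (nat \<Rightarrow> real) \<Rightarrow> nat \<Rightarrow> real" where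
  "fnn n_in [] v = v"
| "fnn n_in (L # Ls) v = fnn (layer_width L) Ls (layer_map n_in L v)"

text \<open>A subnetwork with one-dimensional input and \<open>p\<close>-dimensional output whose activation functions
  are \<open>m\<close> times differentiable. An affine output layer is one with the identity as activation.\<close>

definition smooth_subnetwork :: "nat \<Rightarrow> nat \<Rightarrow> layer list \<Rightarrow> bool" where
  "smooth_subnetwork p m Ls \<longleftrightarrow> Ls \<noteq> [] \<and> layer_width (last Ls) = p \<and>
     (\<forall>L\<in>set Ls. times_differentiable m (layer_act L))"

definition subnet :: "layer list \<Rightarrow> nat \<Rightarrow> real \<Rightarrow> real" where
  "subnet Ls j t = fnn 1 Ls (\<lambda>_. t) j"

definition tnn :: "nat \<Rightarrow> nat \<Rightarrow> (nat \<Rightarrow> layer list) \<Rightarrow> (nat \<Rightarrow> real) \<Rightarrow> real" where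
  "tnn d p net x = (\<Sum>j=1..p. \<Prod>i=1..d. subnet (net i) j (x i))"


section \<open>The integrand\<close>

type_synonym coeffs = "nat \<Rightarrow> nat \<Rightarrow> ((nat \<Rightarrow> nat) \<Rightarrow> nat) \<Rightarrow> real \<Rightarrow> real"

definition in_L2 :: "real set \<Rightarrow> (real \<Rightarrow> real) \<Rightarrow> bool" where
  "in_L2 S f \<longleftrightarrow> f \<in> borel_measurable (lebesgue_on S) \<and>
     integrable (lebesgue_on S) (\<lambda>t. (f t)\<^sup>2)"

definition coeff_A :: "nat \<Rightarrow> nat \<Rightarrow> coeffs \<Rightarrow> ((nat \<Rightarrow> nat) \<Rightarrow> nat) \<Rightarrow> (nat \<Rightarrow> real) \<Rightarrow> real" where
  "coeff_A d q B \<alpha> x = (\<Sum>l=1..q. \<Prod>i=1..d. B i l \<alpha> (x i))"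

definition integrand ::
    "nat \<Rightarrow> nat \<Rightarrow> nat \<Rightarrow> nat \<Rightarrow> nat \<Rightarrow> (nat \<Rightarrow> layer list) \<Rightarrow> coeffs \<Rightarrow> (nat \<Rightarrow> real) \<Rightarrow> real" where
  "integrand d p q m k net B x =
     (\<Sum>\<alpha>\<in>idx_A d m k. coeff_A d q B \<alpha> x *
        (\<Prod>\<beta>\<in>idx_B d m. multi_deriv d \<beta> (tnn d p net) x ^ \<alpha> \<beta>))"

text \<open>The completion of the product of the one-dimensional Lebesgue-Borel measures is
  \<open>d\<close>-dimensional Lebesgue measure.\<close>

definition lebesgue_pow :: "nat \<Rightarrow> (nat \<Rightarrow> real) measure" where
  "lebesgue_pow d = completion (PiM {1..d} (\<lambda>_. lborel))"

definition box_of :: "nat \<Rightarrow> (nat \<Rightarrow> real set) \<Rightarrow> (nat \<Rightarrow> real) set" where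
  "box_of d \<Omega> = PiE {1..d} \<Omega>"


section \<open>Gauss points and weights\<close>

definition orthogonal_poly :: "real \<Rightarrow> real \<Rightarrow> nat \<Rightarrow> real poly \<Rightarrow> bool" where
  "orthogonal_poly a b N P \<longleftrightarrow> degree P = N \<and>
     (\<forall>Q. degree Q < N \<longrightarrow> integral {a..b} (\<lambda>t. poly P t * poly Q t) = 0)"

text \<open>The points \<open>x 1, \<dots>, x N\<close> enumerate the zeros of the degree-\<open>N\<close> orthogonal (Legendre)
  polynomial on the interval; the weights are the integrals of the Lagrange basis polynomials.\<close>

definition gauss_rule ::
    "real \<Rightarrow> real \<Rightarrow> nat \<Rightarrow> (nat \<Rightarrow> real) \<Rightarrow> (nat \<Rightarrow> real) \<Rightarrow> bool" where
  "gauss_rule a b N x w \<longleftrightarrow>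
     inj_on x {1..N} \<and>
     (\<exists>P. orthogonal_poly a b N P \<and> x ` {1..N} = {t. poly P t = 0}) \<and>
     (\<forall>n\<in>{1..N}. w n = integral {a..b} (\<lambda>t. \<Prod>l\<in>{1..N} - {n}. (t - x l) / (x n - x l)))"

text \<open>The \<open>N\<close>-point rule on each of the \<open>s\<close> subintervals \<open>[t r, t (r+1)]\<close> of \<open>[a, b]\<close>, all of length
  at most \<open>h\<close>. The rule on the subinterval number \<open>r\<close> occupies the indices \<open>r * N + 1, \<dots>, r * N + N\<close>.\<close>

definition composite_gauss_rule ::
    "real \<Rightarrow> real \<Rightarrow> real \<Rightarrow> nat \<Rightarrow> (nat \<Rightarrow> real) \<Rightarrow> nat \<Rightarrow> (nat \<Rightarrow> real) \<Rightarrow> (nat \<Rightarrow> real) \<Rightarrow> bool" where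
  "composite_gauss_rule a b h s t N x w \<longleftrightarrow>
     t 0 = a \<and> t s = b \<and>
     (\<forall>r<s. t r < t (Suc r) \<and> t (Suc r) - t r \<le> h \<and>
        gauss_rule (t r) (t (Suc r)) N (\<lambda>n. x (r * N + n)) (\<lambda>n. w (r * N + n)))"


section \<open>The two quadrature schemes\<close>

text \<open>\<open>x i n\<close> and \<open>w i n\<close> with \<open>1 \<le> n \<le> N i\<close> are the points and weights in direction \<open>i\<close>.\<close>

definition direct_scheme ::
    "nat \<Rightarrow> nat \<Rightarrow> nat \<Rightarrow> nat \<Rightarrow> nat \<Rightarrow> (nat \<Rightarrow> layer list) \<Rightarrow> coeffs \<Rightarrow>
     (nat \<Rightarrow> nat) \<Rightarrow> (nat \<Rightarrow> nat \<Rightarrow> real) \<Rightarrow> (nat \<Rightarrow> nat \<Rightarrow> real) \<Rightarrow> real" where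
  "direct_scheme d p q m k net B N x w =
     (\<Sum>n\<in>PiE {1..d} (\<lambda>i. {1..N i}). (\<Prod>i=1..d. w i (n i)) *
        (\<Sum>\<alpha>\<in>idx_A d m k. (\<Sum>l=1..q. \<Prod>i=1..d. B i l \<alpha> (x i (n i))) *
           (\<Prod>\<beta>\<in>idx_B_of d m \<alpha>.
              multi_deriv d \<beta> (tnn d p net) (\<lambda>i\<in>{1..d}. x i (n i)) ^ \<alpha> \<beta>)))"

definition splitting_scheme ::
    "nat \<Rightarrow> nat \<Rightarrow> nat \<Rightarrow> nat \<Rightarrow> nat \<Rightarrow> (nat \<Rightarrow> layer list) \<Rightarrow> coeffs \<Rightarrow>
     (nat \<Rightarrow> nat) \<Rightarrow> (nat \<Rightarrow> nat \<Rightarrow> real) \<Rightarrow> (nat \<Rightarrow> nat \<Rightarrow> real) \<Rightarrow> real" where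
  "splitting_scheme d p q m k net B N x w =
     (\<Sum>\<alpha>\<in>idx_A d m k. \<Sum>l=1..q. \<Sum>j\<in>idx_J d m p \<alpha>. \<Prod>i=1..d. \<Sum>n=1..N i.
        w i n * B i l \<alpha> (x i n) *
        (\<Prod>\<beta>\<in>idx_B_of d m \<alpha>. \<Prod>r=1..\<alpha> \<beta>. (deriv ^^ \<beta> i) (subnet (net i) (j (\<beta>, r))) (x i n)))"


section \<open>Computational complexity\<close>

text \<open>Arithmetic programs. The operands of a sum or product node form a multiset, since their
  order matters neither for the result nor for the number of operations.\<close>

datatype prog =
    Given real
  | Eval "real \<Rightarrow> real" real
  | Sum "prog multiset"
  | Prod "prog multiset"

primrec prog_val :: "prog \<Rightarrow> real" where
  "prog_val (Given c) = c"
| "prog_val (Eval f t) = f t"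
| "prog_val (Sum M) = \<Sum>\<^sub># (image_mset prog_val M)"
| "prog_val (Prod M) = \<Prod>\<^sub># (image_mset prog_val M)"

text \<open>Each function evaluation costs \<open>T\<^sub>1\<close>; each binary addition or multiplication costs \<open>1\<close>, so a
  node with \<open>s \<ge> 1\<close> operands needs \<open>s - 1\<close> of them; given data (the quadrature weights) are free.\<close>

primrec prog_cost :: "real \<Rightarrow> prog \<Rightarrow> real" where
  "prog_cost T\<^sub>1 (Given c) = 0"
| "prog_cost T\<^sub>1 (Eval f t) = T\<^sub>1"
| "prog_cost T\<^sub>1 (Sum M) = \<Sum>\<^sub># (image_mset (prog_cost T\<^sub>1) M) + real (size M - 1)"
| "prog_cost T\<^sub>1 (Prod M) = \<Sum>\<^sub># (image_mset (prog_cost T\<^sub>1) M) + real (size M - 1)"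

abbreviation Sum_over :: "'a set \<Rightarrow> ('a \<Rightarrow> prog) \<Rightarrow> prog" where
  "Sum_over S f \<equiv> Sum (image_mset f (mset_set S))"

abbreviation Prod_over :: "'a set \<Rightarrow> ('a \<Rightarrow> prog) \<Rightarrow> prog" where
  "Prod_over S f \<equiv> Prod (image_mset f (mset_set S))"

text \<open>Literal evaluation of the splitting scheme: every occurrence of a one-dimensional function
  in the formula is evaluated anew.\<close>

definition splitting_prog ::
    "nat \<Rightarrow> nat \<Rightarrow> nat \<Rightarrow> nat \<Rightarrow> nat \<Rightarrow> (nat \<Rightarrow> layer list) \<Rightarrow> coeffs \<Rightarrow>
     (nat \<Rightarrow> nat) \<Rightarrow> (nat \<Rightarrow> nat \<Rightarrow> real) \<Rightarrow> (nat \<Rightarrow> nat \<Rightarrow> real) \<Rightarrow> prog" where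
  "splitting_prog d p q m k net B N x w =
     Sum_over (idx_A d m k) (\<lambda>\<alpha>. Sum_over {1..q} (\<lambda>l. Sum_over (idx_J d m p \<alpha>) (\<lambda>j.
       Prod_over {1..d} (\<lambda>i. Sum_over {1..N i} (\<lambda>n.
         Prod {# Given (w i n),
                 Eval (B i l \<alpha>) (x i n),
                 Prod_over (idx_B_of d m \<alpha>) (\<lambda>\<beta>. Prod_over {1..\<alpha> \<beta>} (\<lambda>r.
                   Eval ((deriv ^^ \<beta> i) (subnet (net i) (j (\<beta>, r)))) (x i n))) #})))))"

definition complexity_scale ::
    "nat \<Rightarrow> nat \<Rightarrow> nat \<Rightarrow> nat \<Rightarrow> nat \<Rightarrow> real \<Rightarrow> nat \<Rightarrow> real" where
  "complexity_scale d p q m k T\<^sub>1 N =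
     real d * real q * T\<^sub>1 * real k ^ 2 * real p ^ k * ((real d + real m) ^ m + real k) ^ k * real N"

end

theory Submission
  imports Defs
begin

text \<open>The splitting scheme is the direct scheme with all products of sums multiplied out. Every
  partial derivative of a tensor network is again a sum over \<open>j \<le> p\<close> of products of one-dimensional
  functions (\<open>multi_deriv_tnn\<close>), so a product of powers of such derivatives expands into a sum over
  index tuples \<open>j\<^bsub>\<beta>,r\<^esub>\<close> (\<open>prod_power_sum_eq_sum_idx_J\<close>) whose summands still factor over the
  coordinates; the sum over the tensor grid then factors into one-dimensional sums
  (\<open>splitting_eq_direct\<close>).

  The cost is a count of nodes. A multi-index of order at most \<open>m\<close> in \<open>d\<close> variables arises
  from \<open>0\<close> by \<open>m\<close> steps, each of which raises one of the \<open>d\<close> entries or none, hence \<open>|\<B>| \<le> (d+1)\<^sup>m\<close> and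
  in the same way \<open>|\<A>| \<le> (|\<B>|+1)\<^sup>k\<close> (\<open>card_bounded_sum_functions\<close>). There are at most \<open>p\<^sup>k\<close> index tuples
  for each \<open>\<alpha>\<close>, and an innermost product has at most \<open>k+2\<close> factors. Each of the five nested
  sums and products at most doubles the cost per operand, which gives an absolute constant.

  For the accuracy, an \<open>N\<close>-point Gauss rule has nodes inside its interval, is exact in degree below
  \<open>2 N\<close> and has nonnegative weights. Hence its error is at most twice the length of the
  interval times the uniform distance of the integrand to a polynomial of such a degree, and the
  Taylor polynomial of degree \<open>n - 1\<close> at the midpoint, with \<open>n\<close> twice the least number of
  points, is at distance at most \<open>M h\<^sup>n / n!\<close>. Summing over the mesh cells gives the
  one-dimensional estimate (\<open>composite_gauss_smooth_error_le\<close>). In \<open>d\<close> dimensions the integrals are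
  replaced by quadrature sums one coordinate at a time (\<open>tensor_quadrature_error_le\<close>): every
  replacement adds one one-dimensional error times the lengths of the other sides, and because the weights are
  nonnegative and sum to the length of the side, the other errors are only multiplied by that length.

  Smoothness of the integrand is available inside the open box. The nodes lie there, and the faces of the box
  form a Lebesgue null set, so the values on the boundary influence neither the scheme nor
  the integral.\<close>


section \<open>Derivatives of tensor networks\<close>

lemma times_differentiable_0 [simp]: "times_differentiable 0 f"
  by (simp add: times_differentiable_def)

lemma times_differentiable_Suc:
  "times_differentiable (Suc m) f \<longleftrightarrow>
     (\<forall>t. f field_differentiable (at t)) \<and> times_differentiable m (deriv f)"
  by (simp add: times_differentiable_def All_less_Suc2 funpow_Suc_right del: funpow.simps)

lemma times_differentiable_mono:
  "times_differentiable n f \<Longrightarrow> m \<le> n \<Longrightarrow> times_differentiable m f"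
  by (auto simp: times_differentiable_def)

lemma times_differentiable_SucD: "times_differentiable (Suc m) f \<Longrightarrow> times_differentiable m f"
  by (rule times_differentiable_mono) auto

lemma times_differentiable_const: "times_differentiable m (\<lambda>_. c)"
  by (induction m arbitrary: c) (simp_all add: times_differentiable_Suc)

lemma times_differentiable_ident: "times_differentiable m (\<lambda>t. t)"
  by (cases m) (simp_all add: times_differentiable_Suc times_differentiable_const)

lemma times_differentiable_add:
  "times_differentiable m f \<Longrightarrow> times_differentiable m g \<Longrightarrow> times_differentiable m (\<lambda>t. f t + g t)"
proof (induction m arbitrary: f g)
  case (Suc m)
  then have "deriv (\<lambda>t. f t + g t) = (\<lambda>t. deriv f t + deriv g t)"
    by (auto simp: times_differentiable_Suc)
  with Suc show ?case
    by (auto simp: times_differentiable_Suc intro!: derivative_intros)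
qed simp

lemma times_differentiable_mult:
  "times_differentiable m f \<Longrightarrow> times_differentiable m g \<Longrightarrow> times_differentiable m (\<lambda>t. f t * g t)"
proof (induction m arbitrary: f g)
  case (Suc m)
  then have "deriv (\<lambda>t. f t * g t) = (\<lambda>t. f t * deriv g t + deriv f t * g t)"
    by (auto simp: times_differentiable_Suc)
  with Suc show ?case
    by (auto simp: times_differentiable_Suc times_differentiable_SucD
        intro!: derivative_intros times_differentiable_add)
qed simp

lemma times_differentiable_sum:
  "(\<And>c. c \<in> S \<Longrightarrow> times_differentiable m (f c)) \<Longrightarrow> times_differentiable m (\<lambda>t. \<Sum>c\<in>S. f c t)"
proof (induction S rule: infinite_finite_induct)
  case (insert c S)
  then show ?case
    using times_differentiable_add[of m "f c" "\<lambda>t. \<Sum>c\<in>S. f c t"] by simp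
qed (simp_all add: times_differentiable_const)

lemma times_differentiable_compose:
  "times_differentiable m f \<Longrightarrow> times_differentiable m g \<Longrightarrow> times_differentiable m (\<lambda>t. f (g t))"
proof (induction m arbitrary: f g)
  case (Suc m)
  then have "((\<lambda>t. f (g t)) has_field_derivative deriv f (g t) * deriv g t) (at t)" for t
    by (intro DERIV_chain2 field_differentiable_derivI) (auto simp: times_differentiable_Suc)
  moreover from this have "deriv (\<lambda>t. f (g t)) = (\<lambda>t. deriv f (g t) * deriv g t)"
    by (intro ext DERIV_imp_deriv)
  ultimately show ?case
    using Suc by (auto simp: times_differentiable_Suc times_differentiable_SucD
        field_differentiable_def intro!: times_differentiable_mult)
qed simp

text \<open>The input vector depends on a real parameter \<open>t\<close>, so that the induction over the layers can
  pass the output of one layer, itself a function of \<open>t\<close>, on to the next.\<close>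

lemma times_differentiable_fnn:
  assumes "\<forall>L\<in>set Ls. times_differentiable m (layer_act L)"
    and "\<And>c. times_differentiable m (\<lambda>t. v t c)"
  shows "times_differentiable m (\<lambda>t. fnn n_in Ls (v t) j)"
  using assms
proof (induction Ls arbitrary: n_in v)
  case (Cons L Ls)
  have "times_differentiable m (\<lambda>t. layer_map n_in L (v t) c)" for c
  proof -
    have "times_differentiable m (\<lambda>t. layer_weight L c i * v t i)" for i
      by (rule times_differentiable_mult[OF times_differentiable_const Cons.prems(2)])
    then have "times_differentiable m (\<lambda>t. \<Sum>i=1..n_in. layer_weight L c i * v t i)"
      by (rule times_differentiable_sum)
    then have "times_differentiable m (\<lambda>t. (\<Sum>i=1..n_in. layer_weight L c i * v t i) + layer_bias L c)"
      by (rule times_differentiable_add[OF _ times_differentiable_const])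
    then show ?thesis
      unfolding layer_map_def using Cons.prems(1) by (simp add: times_differentiable_compose[of m "layer_act L"])
  qed
  then show ?case
    unfolding fnn.simps using Cons.prems(1) by (intro Cons.IH) auto
qed simp

lemma times_differentiable_subnet:
  "smooth_subnetwork p m Ls \<Longrightarrow> times_differentiable m (subnet Ls j)"
  unfolding subnet_def smooth_subnetwork_def
  by (rule times_differentiable_fnn) (simp_all add: times_differentiable_ident)


text \<open>A tensor network with its subnetworks replaced by arbitrary one-dimensional functions:
  unlike tensor networks, these functions are closed under partial derivatives.\<close>

definition tensor_sum :: "nat \<Rightarrow> nat \<Rightarrow> (nat \<Rightarrow> nat \<Rightarrow> real \<Rightarrow> real) \<Rightarrow> (nat \<Rightarrow> real) \<Rightarrow> real" where
  "tensor_sum d p g x = (\<Sum>j=1..p. \<Prod>i=1..d. g i j (x i))"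

text \<open>In each summand only the \<open>i\<close>-th factor depends on the \<open>i\<close>-th variable, so the other factors act
  as a constant coefficient \<open>c j\<close>.\<close>

lemma part_deriv_tensor_sum:
  assumes "i \<in> {1..d}" "\<And>j t. g i j field_differentiable (at t)"
  shows "part_deriv i (tensor_sum d p g) = tensor_sum d p (g(i := \<lambda>j. deriv (g i j)))"
proof
  fix x
  define c where "c j = (\<Prod>i'\<in>{1..d} - {i}. g i' j (x i'))" for j
  have split: "tensor_sum d p h (x(i := t)) = (\<Sum>j=1..p. h i j t * c j)"
    if "\<And>i'. i' \<noteq> i \<Longrightarrow> h i' = g i'" for h t
  proof -
    have "(\<Prod>i'=1..d. h i' j ((x(i := t)) i')) = h i j t * c j" for j
    proof -
      have "(\<Prod>i'\<in>{1..d} - {i}. h i' j ((x(i := t)) i')) = c j"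
        unfolding c_def using that by (intro prod.cong) auto
      then show ?thesis
        using assms(1) by (subst prod.remove[of _ i]) simp_all
    qed
    then show ?thesis
      by (simp only: tensor_sum_def)
  qed
  have "((\<lambda>t. \<Sum>j=1..p. g i j t * c j) has_field_derivative (\<Sum>j=1..p. deriv (g i j) (x i) * c j)) (at (x i))"
    using assms(2) by (auto intro!: derivative_eq_intros field_differentiable_derivI DERIV_cmult_right)
  then have "part_deriv i (tensor_sum d p g) x = (\<Sum>j=1..p. deriv (g i j) (x i) * c j)"
    by (simp add: part_deriv_def split DERIV_imp_deriv)
  also have "\<dots> = tensor_sum d p (g(i := \<lambda>j. deriv (g i j))) (x(i := x i))"
    by (subst split) auto
  finally show "part_deriv i (tensor_sum d p g) x = tensor_sum d p (g(i := \<lambda>j. deriv (g i j))) x"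
    by simp
qed

lemma part_deriv_funpow_tensor_sum:
  assumes "i \<in> {1..d}" "\<And>j. times_differentiable r (g i j)"
  shows "(part_deriv i ^^ r) (tensor_sum d p g) = tensor_sum d p (g(i := \<lambda>j. (deriv ^^ r) (g i j)))"
  using assms
proof (induction r arbitrary: g)
  case 0
  then show ?case by simp
next
  case (Suc r)
  let ?g = "g(i := \<lambda>j. deriv (g i j))"
  have "(part_deriv i ^^ Suc r) (tensor_sum d p g) = (part_deriv i ^^ r) (tensor_sum d p ?g)"
    using Suc.prems by (simp only: funpow_Suc_right o_apply times_differentiable_Suc part_deriv_tensor_sum)
  also have "\<dots> = tensor_sum d p (?g(i := \<lambda>j. (deriv ^^ r) (?g i j)))"
    using Suc.prems by (intro Suc.IH) (simp_all add: times_differentiable_Suc)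
  finally show ?case
    by (simp only: funpow_Suc_right o_apply fun_upd_upd fun_upd_same)
qed

text \<open>A differentiation in direction \<open>i\<close> touches only the \<open>i\<close>-th factors, so the iterated partial derivatives
  do not interfere. The proof tracks which directions of the list have been processed.\<close>

lemma multi_deriv_tensor_sum:
  assumes "\<And>i j. i \<in> {1..d} \<Longrightarrow> times_differentiable (\<beta> i) (g i j)"
  shows "multi_deriv d \<beta> (tensor_sum d p g) = tensor_sum d p (\<lambda>i j. (deriv ^^ \<beta> i) (g i j))"
proof -
  have "foldr (\<lambda>i. part_deriv i ^^ \<beta> i) is (tensor_sum d p g) =
          tensor_sum d p (\<lambda>i. if i \<in> set is then \<lambda>j. (deriv ^^ \<beta> i) (g i j) else g i)"
    if "set is \<subseteq> {1..d}" "distinct is" for "is"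
    using that
  proof (induction "is")
    case (Cons i "is")
    then have "times_differentiable (\<beta> i)
        ((if i \<in> set is then \<lambda>j. (deriv ^^ \<beta> i) (g i j) else g i) j)" for j
      using assms by auto
    with Cons show ?case
      by (auto simp: part_deriv_funpow_tensor_sum intro!: arg_cong[of _ _ "tensor_sum d p"])
  qed simp
  note foldr = this
  have "multi_deriv d \<beta> (tensor_sum d p g) =
      tensor_sum d p (\<lambda>i. if i \<in> set [1..<Suc d] then \<lambda>j. (deriv ^^ \<beta> i) (g i j) else g i)"
    unfolding multi_deriv_def by (rule foldr) auto
  also have "\<dots> = tensor_sum d p (\<lambda>i j. (deriv ^^ \<beta> i) (g i j))"
    unfolding tensor_sum_def by (intro ext sum.cong prod.cong) auto
  finally show ?thesis .
qed

lemma multi_deriv_tnn: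
  assumes "\<forall>i\<in>{1..d}. smooth_subnetwork p m (net i)" "\<beta> \<in> idx_B d m"
  shows "multi_deriv d \<beta> (tnn d p net) x =
           (\<Sum>j=1..p. \<Prod>i=1..d. (deriv ^^ \<beta> i) (subnet (net i) j) (x i))"
proof -
  have tnn: "tnn d p net = tensor_sum d p (\<lambda>i. subnet (net i))"
    by (simp add: fun_eq_iff tnn_def tensor_sum_def)
  have "times_differentiable (\<beta> i) (subnet (net i) j)" if "i \<in> {1..d}" for i j
  proof -
    have "\<beta> i \<le> m"
      using assms(2) that member_le_sum[of i "{1..d}" \<beta>] by (auto simp: idx_B_def)
    with assms(1) that show ?thesis
      by (blast intro: times_differentiable_mono times_differentiable_subnet)
  qed
  then show ?thesis
    unfolding tnn by (subst multi_deriv_tensor_sum) (simp_all add: tensor_sum_def)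
qed


section \<open>Counting multi-indices\<close>

text \<open>Every function with sum at most \<open>k + 1\<close> is obtained from one with sum at most \<open>k\<close> by raising
  one value by one or by changing nothing. This bounds both sets of multi-indices, since the
  elements of \<open>\<A>\<close> are multi-indices over \<open>\<B>\<close>.\<close>

lemma card_bounded_sum_functions:
  fixes S :: "'a set"
  assumes "finite S"
  defines "F \<equiv> \<lambda>k. {f \<in> S \<rightarrow>\<^sub>E (UNIV :: nat set). (\<Sum>s\<in>S. f s) \<le> k}"
  shows "finite (F k) \<and> card (F k) \<le> (card S + 1) ^ k"
proof (induction k)
  case 0
  have "F 0 \<subseteq> {\<lambda>s\<in>S. 0}"
    using assms(1) by (auto simp: F_def PiE_def extensional_def fun_eq_iff)
  then show ?case
    using finite_subset[of "F 0"] card_mono[of "{\<lambda>s\<in>S. 0}" "F 0"] by simp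
next
  case (Suc k)
  \<comment> \<open>\<open>None\<close> leaves a function alone, \<open>Some s\<close> raises its value at \<open>s\<close> by one.\<close>
  define raise where "raise = (\<lambda>(f :: 'a \<Rightarrow> nat, z). case z of None \<Rightarrow> f | Some s \<Rightarrow> f(s := Suc (f s)))"
  let ?D = "F k \<times> insert None (Some ` S)"
  have "F (Suc k) \<subseteq> raise ` ?D"
  proof
    fix f assume f: "f \<in> F (Suc k)"
    show "f \<in> raise ` ?D"
    proof (cases "f \<in> F k")
      case True
      then show ?thesis
        by (auto simp: raise_def image_iff intro!: bexI[of _ "(f, None)"])
    next
      case False
      with f have sum: "(\<Sum>s\<in>S. f s) = Suc k"
        by (auto simp: F_def)
      then obtain s where s: "s \<in> S" "f s \<noteq> 0"
        by (metis nat.distinct(1) sum.neutral)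
      have "(\<Sum>s'\<in>S. (f(s := f s - 1)) s') = (f s - 1) + (\<Sum>s'\<in>S - {s}. f s')"
        using s assms(1) by (simp add: sum.remove)
      also have "\<dots> = k"
        using sum s assms(1) by (simp add: sum.remove)
      finally have "f(s := f s - 1) \<in> F k"
        using f s by (auto simp: F_def)
      moreover have "f = raise (f(s := f s - 1), Some s)"
        using s by (simp add: raise_def)
      ultimately show ?thesis
        using s by (intro image_eqI) auto
    qed
  qed
  moreover have "card ?D = card (F k) * (card S + 1)"
    using assms(1) by (simp add: card_cartesian_product card_image)
  moreover have "finite ?D"
    using assms(1) Suc by simp
  ultimately have "finite (F (Suc k))" "card (F (Suc k)) \<le> card (F k) * (card S + 1)"
    using surj_card_le[of ?D "F (Suc k)" raise] finite_subset by auto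
  moreover have "card (F k) * (card S + 1) \<le> (card S + 1) ^ Suc k"
    using Suc by (simp only: power_Suc2 mult_le_mono1)
  ultimately show ?case
    by linarith
qed

lemma finite_idx_B: "finite (idx_B d m)"
  and card_idx_B: "card (idx_B d m) \<le> (d + 1) ^ m"
  using card_bounded_sum_functions[of "{1..d}" m] by (auto simp: idx_B_def)

lemma card_idx_A: "card (idx_A d m k) \<le> (card (idx_B d m) + 1) ^ k"
  using card_bounded_sum_functions[OF finite_idx_B, of d m k] by (auto simp: idx_A_def)

lemma finite_idx_B_of: "finite (idx_B_of d m \<alpha>)"
  using finite_idx_B by (simp add: idx_B_of_def)

lemma sum_idx_B_of_le: "\<alpha> \<in> idx_A d m k \<Longrightarrow> (\<Sum>\<beta>\<in>idx_B_of d m \<alpha>. \<alpha> \<beta>) \<le> k"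
  using sum_mono2[OF finite_idx_B, of "idx_B_of d m \<alpha>" d m \<alpha>]
  by (auto simp: idx_A_def idx_B_of_def)

lemma card_idx_J: "p \<ge> 1 \<Longrightarrow> \<alpha> \<in> idx_A d m k \<Longrightarrow> card (idx_J d m p \<alpha>) \<le> p ^ k"
  unfolding idx_J_def
  by (simp add: card_funcsetE finite_idx_B_of sum_idx_B_of_le power_increasing)


section \<open>Equivalence of the two schemes\<close>

text \<open>The power \<open>\<alpha> \<beta>\<close> is a product over \<open>r\<close> of \<open>\<alpha> \<beta>\<close> equal sums. Multiplying out the product over all
  pairs \<open>(\<beta>, r)\<close> chooses one summation index for each pair, which is an element of \<open>idx_J\<close>.\<close>

lemma prod_power_sum_eq_sum_idx_J:
  fixes a :: "(nat \<Rightarrow> nat) \<Rightarrow> nat \<Rightarrow> 'a :: comm_semiring_1"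
  shows "(\<Prod>\<beta>\<in>idx_B_of d m \<alpha>. (\<Sum>j=1..p. a \<beta> j) ^ \<alpha> \<beta>) =
         (\<Sum>j\<in>idx_J d m p \<alpha>. \<Prod>\<beta>\<in>idx_B_of d m \<alpha>. \<Prod>r=1..\<alpha> \<beta>. a \<beta> (j (\<beta>, r)))"
proof -
  have "(\<Prod>\<beta>\<in>idx_B_of d m \<alpha>. (\<Sum>j=1..p. a \<beta> j) ^ \<alpha> \<beta>) =
        (\<Prod>\<beta>\<in>idx_B_of d m \<alpha>. \<Prod>r=1..\<alpha> \<beta>. \<Sum>j=1..p. a \<beta> j)"
    by simp
  also have "\<dots> = (\<Prod>(\<beta>, r)\<in>(SIGMA \<beta>:idx_B_of d m \<alpha>. {1..\<alpha> \<beta>}). \<Sum>j=1..p. a \<beta> j)"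
    by (rule prod.Sigma) (auto simp: finite_idx_B_of)
  also have "\<dots> = (\<Sum>j\<in>idx_J d m p \<alpha>. \<Prod>z\<in>(SIGMA \<beta>:idx_B_of d m \<alpha>. {1..\<alpha> \<beta>}). a (fst z) (j z))"
    unfolding idx_J_def case_prod_unfold by (rule prod_sum_PiE) (auto simp: finite_idx_B_of)
  also have "\<dots> = (\<Sum>j\<in>idx_J d m p \<alpha>. \<Prod>\<beta>\<in>idx_B_of d m \<alpha>. \<Prod>r=1..\<alpha> \<beta>. a \<beta> (j (\<beta>, r)))"
    by (subst prod.Sigma) (auto simp: finite_idx_B_of case_prod_unfold)
  finally show ?thesis .
qed

text \<open>Read from the splitting scheme: the product over \<open>i\<close> of sums over \<open>n\<^sub>i\<close> becomes a sum over the
  grid \<open>\<N>\<close>, which is then moved outwards past the sums over \<open>j\<close>, \<open>l\<close> and \<open>\<alpha>\<close>.\<close>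

lemma splitting_eq_direct:
  assumes "\<forall>i\<in>{1..d}. smooth_subnetwork p m (net i)"
  shows "splitting_scheme d p q m k net B N x w = direct_scheme d p q m k net B N x w"
proof -
  define \<N> where "\<N> = PiE {1..d} (\<lambda>i. {1..N i})"
  define D where "D \<alpha> j i t = (\<Prod>\<beta>\<in>idx_B_of d m \<alpha>. \<Prod>r=1..\<alpha> \<beta>.
      (deriv ^^ \<beta> i) (subnet (net i) (j (\<beta>, r))) t)" for \<alpha> j i t
  have deriv: "(\<Prod>\<beta>\<in>idx_B_of d m \<alpha>.
       multi_deriv d \<beta> (tnn d p net) (\<lambda>i\<in>{1..d}. x i (n i)) ^ \<alpha> \<beta>) =
       (\<Sum>j\<in>idx_J d m p \<alpha>. \<Prod>i=1..d. D \<alpha> j i (x i (n i)))" for \<alpha> n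
  proof -
    have "(\<Prod>\<beta>\<in>idx_B_of d m \<alpha>. multi_deriv d \<beta> (tnn d p net) (\<lambda>i\<in>{1..d}. x i (n i)) ^ \<alpha> \<beta>) =
        (\<Prod>\<beta>\<in>idx_B_of d m \<alpha>.
          (\<Sum>j=1..p. \<Prod>i=1..d. (deriv ^^ \<beta> i) (subnet (net i) j) (x i (n i))) ^ \<alpha> \<beta>)"
      using assms by (intro prod.cong refl) (auto simp: idx_B_of_def multi_deriv_tnn)
    also have "\<dots> = (\<Sum>j\<in>idx_J d m p \<alpha>. \<Prod>i=1..d. D \<alpha> j i (x i (n i)))"
      unfolding prod_power_sum_eq_sum_idx_J D_def
      by (subst prod.swap, subst (2) prod.swap) (simp add: prod.swap[of _ "{1..d}"])
    finally show ?thesis .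
  qed
  have "splitting_scheme d p q m k net B N x w =
      (\<Sum>\<alpha>\<in>idx_A d m k. \<Sum>l=1..q. \<Sum>j\<in>idx_J d m p \<alpha>. \<Sum>n\<in>\<N>.
         \<Prod>i=1..d. w i (n i) * B i l \<alpha> (x i (n i)) * D \<alpha> j i (x i (n i)))"
    unfolding splitting_scheme_def \<N>_def D_def
    by (intro sum.cong refl prod_sum_PiE) auto
  also have "\<dots> = (\<Sum>\<alpha>\<in>idx_A d m k. \<Sum>l=1..q. \<Sum>n\<in>\<N>. \<Sum>j\<in>idx_J d m p \<alpha>.
         (\<Prod>i=1..d. w i (n i)) * ((\<Prod>i=1..d. B i l \<alpha> (x i (n i))) * (\<Prod>i=1..d. D \<alpha> j i (x i (n i)))))"
    by (subst (3) sum.swap) (simp only: prod.distrib mult.assoc)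
  also have "\<dots> = (\<Sum>\<alpha>\<in>idx_A d m k. \<Sum>n\<in>\<N>. \<Sum>l=1..q. (\<Prod>i=1..d. w i (n i)) *
         ((\<Prod>i=1..d. B i l \<alpha> (x i (n i))) * (\<Sum>j\<in>idx_J d m p \<alpha>. \<Prod>i=1..d. D \<alpha> j i (x i (n i)))))"
    by (subst (4) sum.swap) (simp only: sum_distrib_left)
  also have "\<dots> = (\<Sum>n\<in>\<N>. \<Sum>\<alpha>\<in>idx_A d m k. (\<Prod>i=1..d. w i (n i)) * ((\<Sum>l=1..q.
         \<Prod>i=1..d. B i l \<alpha> (x i (n i))) * (\<Sum>j\<in>idx_J d m p \<alpha>. \<Prod>i=1..d. D \<alpha> j i (x i (n i)))))"
    by (subst sum.swap) (simp only: sum_distrib_left [symmetric] sum_distrib_right [symmetric])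
  also have "\<dots> = direct_scheme d p q m k net B N x w"
    unfolding direct_scheme_def \<N>_def deriv by (simp add: sum_distrib_left)
  finally show ?thesis .
qed


section \<open>Cost of the splitting scheme\<close>

lemma prog_val_over:
  "prog_val (Sum_over S f) = (\<Sum>s\<in>S. prog_val (f s))"
  "prog_val (Prod_over S f) = (\<Prod>s\<in>S. prog_val (f s))"
  by (simp_all add: sum_unfold_sum_mset prod_unfold_prod_mset image_mset.compositionality o_def)

lemma prog_val_splitting_prog:
  "prog_val (splitting_prog d p q m k net B N x w) = splitting_scheme d p q m k net B N x w"
  unfolding splitting_prog_def splitting_scheme_def prog_val_over
  by (simp add: prog_val_over mult.assoc del: prog_val.simps(3,4) add: prog_val.simps(4)[of "add_mset _ _"])

lemma prog_cost_over:
  "prog_cost T (Sum_over S f) = (\<Sum>s\<in>S. prog_cost T (f s)) + real (card S - 1)"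
  "prog_cost T (Prod_over S f) = (\<Sum>s\<in>S. prog_cost T (f s)) + real (card S - 1)"
  by (simp_all add: sum_unfold_sum_mset image_mset.compositionality o_def)

text \<open>The at most \<open>X\<close> operations of a node are charged to its operands. As \<open>c \<ge> 1\<close>, this at most doubles
  the cost of each operand, so nested nodes can be bounded one after the other.\<close>

lemma prog_cost_over_le:
  assumes "\<And>s. s \<in> S \<Longrightarrow> prog_cost T (f s) \<le> c" "real (card S) \<le> X" "1 \<le> c"
  shows "prog_cost T (Sum_over S f) \<le> X * (2 * c)"
    and "prog_cost T (Prod_over S f) \<le> X * (2 * c)"
proof -
  have "(\<Sum>s\<in>S. prog_cost T (f s)) \<le> real (card S) * c"
    using sum_bounded_above[of S "\<lambda>s. prog_cost T (f s)" c] assms(1) by simp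
  moreover have "real (card S - 1) \<le> real (card S) * c"
    using assms(3) mult_left_mono[of 1 c "real (card S)"] by simp
  moreover have "real (card S) * c \<le> X * c"
    using assms(2,3) by (intro mult_right_mono) auto
  ultimately show "prog_cost T (Sum_over S f) \<le> X * (2 * c)"
    and "prog_cost T (Prod_over S f) \<le> X * (2 * c)"
    unfolding prog_cost_over by linarith+
qed

text \<open>An innermost product costs at most \<open>5 k T\<close>. It lies below five nodes, over \<open>\<alpha>\<close>, \<open>l\<close>, \<open>j\<close>, \<open>i\<close> and \<open>n\<close>,
  each contributing its number of operands and a factor \<open>2\<close>, and \<open>2\<^sup>5 * 5 = 160\<close>.\<close>

lemma prog_cost_splitting_prog_le:
  assumes "d \<ge> 1" "p \<ge> 1" "q \<ge> 1" "m \<ge> 1" "k \<ge> 1" "T \<ge> 1" "\<And>i. i \<in> {1..d} \<Longrightarrow> N i \<ge> 1"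
  shows "prog_cost T (splitting_prog d p q m k net B N x w)
           \<le> 160 * complexity_scale d p q m k T (Max (N ` {1..d}))"
proof -
  define D where "D = (\<lambda>\<alpha> j i n. Prod_over (idx_B_of d m \<alpha>) (\<lambda>\<beta>. Prod_over {1..\<alpha> \<beta>} (\<lambda>r.
      Eval ((deriv ^^ \<beta> i) (subnet (net i) (j (\<beta>, r)))) (x i n))))"
  define N' where "N' = Max (N ` {1..d})"
  define c where "c = 5 * real k * T"
  have D: "prog_cost T (D \<alpha> j i n) \<le> 2 * real k * T" if "\<alpha> \<in> idx_A d m k" for \<alpha> j i n
  proof -
    let ?S = "idx_B_of d m \<alpha>"
    \<comment> \<open>The node over \<open>r\<close> has \<open>\<alpha> \<beta> - 1\<close> multiplications; the missing unit is paid by the node over \<open>\<beta>\<close>.\<close>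
    have "prog_cost T (D \<alpha> j i n) = (\<Sum>\<beta>\<in>?S. real (\<alpha> \<beta>) * T + real (\<alpha> \<beta> - 1)) + real (card ?S - 1)"
      unfolding D_def prog_cost_over by simp
    also have "\<dots> \<le> (\<Sum>\<beta>\<in>?S. real (\<alpha> \<beta>) * T + real (\<alpha> \<beta> - 1)) + (\<Sum>\<beta>\<in>?S. 1)"
      by simp
    also have "\<dots> = (\<Sum>\<beta>\<in>?S. real (\<alpha> \<beta>) * (T + 1))"
      unfolding sum.distrib [symmetric]
      by (intro sum.cong refl) (auto simp: idx_B_of_def of_nat_diff algebra_simps)
    also have "\<dots> = real (\<Sum>\<beta>\<in>?S. \<alpha> \<beta>) * (T + 1)"
      by (simp add: sum_distrib_right)
    also have "\<dots> \<le> real k * (2 * T)"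
      using of_nat_mono[OF sum_idx_B_of_le[OF that], where ?'a = real] assms(6)
      by (intro mult_mono) simp_all
    finally show ?thesis
      by simp
  qed
  have kT: "real k \<ge> 1" "T \<le> real k * T" "1 \<le> real k * T"
    using assms(5,6) mult_mono[of 1 "real k" 1 T] mult_right_mono[of 1 "real k" T] by auto
  have summand: "prog_cost T (Prod {# Given (w i n), Eval (B i l \<alpha>) (x i n), D \<alpha> j i n #}) \<le> c"
    if "\<alpha> \<in> idx_A d m k" for \<alpha> j i n l
    using D[OF that, of j i n] kT unfolding c_def by simp
  have c: "1 \<le> c"
    unfolding c_def using kT by simp
  have N: "real (card {1..N i}) \<le> real N'" if "i \<in> {1..d}" for i
    unfolding N'_def using that by auto
  have N': "real N' \<ge> 1"
    using N[of 1] assms(1) assms(7)[of 1] by simp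
  let ?c1 = "real N' * (2 * c)"
  let ?c2 = "real d * (2 * ?c1)"
  let ?c3 = "real p ^ k * (2 * ?c2)"
  let ?c4 = "real q * (2 * ?c3)"
  let ?A = "((real d + real m) ^ m + real k) ^ k"
  have ge1: "1 \<le> X * (2 * y)" if "1 \<le> X" "1 \<le> y" for X y :: real
    using mult_mono[of 1 X 1 "2 * y"] that by simp
  have c1: "1 \<le> ?c1"
    using N' c by (rule ge1)
  have c2: "1 \<le> ?c2"
    using assms(1) by (intro ge1[OF _ c1]) auto
  have c3: "1 \<le> ?c3"
    using assms(2) by (intro ge1[OF _ c2]) auto
  have c4: "1 \<le> ?c4"
    using assms(3) by (intro ge1[OF _ c3]) auto
  have card_J: "real (card (idx_J d m p \<alpha>)) \<le> real p ^ k" if "\<alpha> \<in> idx_A d m k" for \<alpha>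
    using card_idx_J[OF assms(2) that] of_nat_mono by fastforce
  have "real (card (idx_A d m k)) \<le> (real (card (idx_B d m)) + 1) ^ k"
    using of_nat_mono[OF card_idx_A[of d m k], where ?'a = real] by (simp add: add.commute)
  also have "\<dots> \<le> ?A"
  proof (intro power_mono add_mono)
    have "real (card (idx_B d m)) \<le> (real d + 1) ^ m"
      using of_nat_mono[OF card_idx_B[of d m], where ?'a = real] by (simp add: add.commute)
    also have "\<dots> \<le> (real d + real m) ^ m"
      using assms(4) by (intro power_mono) auto
    finally show "real (card (idx_B d m)) \<le> (real d + real m) ^ m" .
  qed (use assms(5) in auto)
  finally have card_A: "real (card (idx_A d m k)) \<le> ?A" .
  have "prog_cost T (splitting_prog d p q m k net B N x w) \<le> ?A * (2 * ?c4)"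
    unfolding splitting_prog_def
    using c c1 c2 c3 c4 card_A card_J N
    by (intro prog_cost_over_le summand [unfolded D_def]) simp_all
  also have "\<dots> = 160 * (real d * real q * T * real k * real p ^ k * ?A * real N')"
    by (simp add: c_def)
  also have "\<dots> \<le> 160 * complexity_scale d p q m k T N'"
  proof -
    have "real k \<le> real k ^ 2"
      using kT(1) by (simp add: power2_eq_square)
    then show ?thesis
      unfolding complexity_scale_def using assms(6)
      by (intro mult_left_mono mult_right_mono) auto
  qed
  finally show ?thesis
    by (simp only: N'_def)
qed

text \<open>The exponents \<open>m\<close> and \<open>k\<close> do not depend on \<open>d\<close>, so the bound is literally a polynomial
  expression in \<open>d\<close>.\<close>

lemma complexity_scale_poly:
  "\<exists>P :: real poly. \<forall>d. complexity_scale d p q m k T N = poly P (real d)"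
  by (rule exI[of _ "[:0, 1:] * [:real q * T * real k ^ 2 * real p ^ k:] *
        ([:real m, 1:] ^ m + [:real k:]) ^ k * [:real N:]"])
     (simp add: complexity_scale_def poly_power add.commute)


section \<open>Gauss quadrature on one interval\<close>

text \<open>If some zero of the orthogonal polynomial \<open>P\<close> lay outside the open interval, the monic polynomial
  \<open>node I\<close> whose zeros are the zeros of \<open>P\<close> inside would have degree below \<open>N\<close> and be orthogonal to \<open>P\<close>. But
  in \<open>P * node I\<close> the interior zeros are double and the outer ones cause no sign change
  on the interval, so its integral cannot vanish.\<close>

lemma gauss_points_interior:
  assumes ab: "a < b" and N: "N \<ge> 1" and gauss: "gauss_rule a b N x w" and n: "n \<in> {1..N}"
  shows "x n \<in> {a<..<b}"
proof (rule ccontr)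
  assume out: "x n \<notin> {a<..<b}"
  obtain P where inj: "inj_on x {1..N}" and P: "degree P = N"
    and orth: "\<And>Q. degree Q < N \<Longrightarrow> integral {a..b} (\<lambda>t. poly P t * poly Q t) = 0"
    and roots: "x ` {1..N} = {t. poly P t = 0}"
    using gauss unfolding gauss_rule_def orthogonal_poly_def by blast
  define Z where "Z = x ` {1..N}"
  define node where "node S = (\<Prod>z\<in>S. [:- z, 1:])" for S :: "real set"
  define c where "c = lead_coeff P"
  have Z: "finite Z" "card Z = N"
    using inj by (simp_all add: Z_def card_image)
  have c: "c \<noteq> 0"
    using P N by (auto simp: c_def)
  have degree_node: "degree (node S) = card S" for S
    by (simp add: node_def degree_prod_sum_eq)
  have "lead_coeff (node S) = 1" for S
    unfolding node_def lead_coeff_prod by simp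
  note node = degree_node this [unfolded degree_node]
  have poly_node: "poly (node S) t = (\<Prod>z\<in>S. t - z)" for S t
    by (simp add: node_def poly_prod)
  have "P = smult c (node Z)"
  proof (rule poly_eqI_degree_lead_coeff[of _ N _ Z])
    show "coeff P N = coeff (smult c (node Z)) N"
      using P Z node[of Z] by (simp add: c_def)
    fix z assume "z \<in> Z"
    then have "poly P z = 0" "poly (node Z) z = 0"
      using roots Z by (auto simp: Z_def poly_node)
    then show "poly P z = poly (smult c (node Z)) z"
      by simp
  qed (use P Z node[of Z] in auto)
  \<comment> \<open>Up to a nonzero constant, \<open>f\<close> is \<open>P * node I\<close>; the signs \<open>\<sigma>\<close> make its outer factors nonnegative.\<close>
  define I where "I = Z \<inter> {a<..<b}"
  define Out where "Out = Z - {a<..<b}"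
  define \<sigma> :: "real \<Rightarrow> real" where "\<sigma> z = (if z \<le> a then 1 else - 1)" for z
  define f where "f t = (\<Prod>z\<in>I. t - z)\<^sup>2 * (\<Prod>z\<in>Out. \<sigma> z * (t - z))" for t
  have fin: "finite I" "finite Out"
    using Z by (auto simp: I_def Out_def)
  have "x n \<in> Out"
    using out n by (auto simp: Out_def Z_def)
  then have "I \<subset> Z"
    by (auto simp: Out_def I_def)
  then have "degree (node I) < N"
    using Z psubset_card_mono[of Z I] node by simp
  then have "integral {a..b} (\<lambda>t. poly P t * poly (node I) t) = 0"
    by (rule orth)
  moreover have f: "f t = (\<Prod>z\<in>Out. \<sigma> z) / c * (poly P t * poly (node I) t)" for t
  proof -
    have "(\<Prod>z\<in>Z. t - z) = (\<Prod>z\<in>I. t - z) * (\<Prod>z\<in>Out. t - z)"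
      using fin by (subst prod.union_disjoint [symmetric]) (auto simp: I_def Out_def intro: prod.cong)
    then show ?thesis
      using c \<open>P = smult c (node Z)\<close>
      by (simp add: f_def poly_node prod.distrib power2_eq_square)
  qed
  ultimately have "integral {a..b} f = 0"
    unfolding f by simp
  moreover have "continuous_on {a..b} f"
    unfolding f_def by (intro continuous_intros)
  moreover have "0 \<le> f t" if "t \<in> {a..b}" for t
    unfolding f_def using that
    by (intro mult_nonneg_nonneg[OF zero_le_power2] prod_nonneg ballI) (auto simp: \<sigma>_def Out_def)
  ultimately have "\<forall>t\<in>{a..b}. f t = 0"
    using ab integral_eq_0_iff by blast
  then have "{a..b} \<subseteq> Z"
    using fin by (auto simp: f_def \<sigma>_def I_def Out_def split: if_splits)
  then show False
    using Z(1) ab finite_subset infinite_Icc by blast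
qed

lemma integrable_poly: "(\<lambda>t. poly p t) integrable_on {a..b :: real}"
  by (intro integrable_continuous_real continuous_intros)

definition lagrange_poly :: "nat \<Rightarrow> (nat \<Rightarrow> real) \<Rightarrow> nat \<Rightarrow> real poly" where
  "lagrange_poly N x n = (\<Prod>l\<in>{1..N} - {n}. smult (1 / (x n - x l)) [:- x l, 1:])"

lemma poly_lagrange_poly:
  "poly (lagrange_poly N x n) t = (\<Prod>l\<in>{1..N} - {n}. (t - x l) / (x n - x l))"
  by (simp add: lagrange_poly_def poly_prod diff_divide_distrib)

lemma poly_lagrange_poly_node:
  assumes "inj_on x {1..N}" "n \<in> {1..N}" "l \<in> {1..N}"
  shows "poly (lagrange_poly N x n) (x l) = (if l = n then 1 else 0)"
proof (cases "l = n")
  case True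
  have "x n \<noteq> x i" if "i \<in> {1..N} - {n}" for i
    using that assms(2) inj_onD[OF assms(1), of n i] by auto
  with True show ?thesis
    unfolding poly_lagrange_poly by (simp add: prod.neutral)
next
  case False
  then have "l \<in> {1..N} - {n}"
    using assms by auto
  then have "(\<Prod>i\<in>{1..N} - {n}. (x l - x i) / (x n - x i)) = 0"
    by (intro prod_zero) auto
  with False show ?thesis
    by (simp add: poly_lagrange_poly)
qed

lemma degree_lagrange_poly: 
  assumes "n \<in> {1..N}"
  shows "degree (lagrange_poly N x n) < N"
proof -
  have "degree (lagrange_poly N x n) \<le> (\<Sum>l\<in>{1..N} - {n}. 1)"
    unfolding lagrange_poly_def
    by (intro order.trans[OF degree_prod_sum_le] sum_mono) auto
  also have "\<dots> < N"
    using assms by (simp add: card_Diff_singleton)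
  finally show ?thesis .
qed

lemma gauss_weight_eq_integral_lagrange:
  "gauss_rule a b N x w \<Longrightarrow> n \<in> {1..N} \<Longrightarrow> w n = integral {a..b} (poly (lagrange_poly N x n))"
  unfolding gauss_rule_def poly_lagrange_poly [abs_def] by blast

text \<open>Division by the orthogonal polynomial \<open>P\<close> writes \<open>R = P * Q + S\<close> with \<open>Q\<close> and \<open>S\<close> of degree below \<open>N\<close>.
  The term \<open>P * Q\<close> integrates to zero by orthogonality and vanishes at the nodes, and \<open>S\<close> is its own
  Lagrange interpolant, which the rule integrates exactly by the choice of the weights.\<close>

lemma gauss_exact:
  assumes N: "N \<ge> 1" and gauss: "gauss_rule a b N x w" and R: "degree R < 2 * N"
  shows "integral {a..b} (poly R) = (\<Sum>n=1..N. w n * poly R (x n))"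
proof -
  obtain P where inj: "inj_on x {1..N}" and P: "degree P = N"
    and orth: "\<And>Q. degree Q < N \<Longrightarrow> integral {a..b} (\<lambda>t. poly P t * poly Q t) = 0"
    and roots: "x ` {1..N} = {t. poly P t = 0}"
    using gauss unfolding gauss_rule_def orthogonal_poly_def by blast
  define Q S where "Q = R div P" and "S = R mod P"
  have eq: "R = P * Q + S"
    by (simp add: Q_def S_def)
  have P0: "P \<noteq> 0"
    using P N by auto
  have S: "degree S < N"
    using degree_mod_less[OF P0, of R] P N by (auto simp: S_def)
  have Q: "degree Q < N"
  proof (rule ccontr)
    assume "\<not> degree Q < N"
    then have "Q \<noteq> 0"
      using N by auto
    with \<open>\<not> degree Q < N\<close> have "degree (P * Q) = N + degree Q" "N \<le> degree Q"
      using P P0 N by (auto simp: degree_mult_eq)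
    then have "degree R = N + degree Q"
      using S by (simp add: eq degree_add_eq_left)
    with R \<open>N \<le> degree Q\<close> show False
      by simp
  qed
  have "S = (\<Sum>n=1..N. smult (poly S (x n)) (lagrange_poly N x n))"
  proof (rule poly_eqI_degree[of "x ` {1..N}"])
    fix z assume "z \<in> x ` {1..N}"
    then obtain l where l: "l \<in> {1..N}" "z = x l"
      by auto
    have "(\<Sum>n=1..N. poly S (x n) * poly (lagrange_poly N x n) (x l)) =
          (\<Sum>n=1..N. if n = l then poly S (x n) else 0)"
      using inj l by (intro sum.cong) (auto simp: poly_lagrange_poly_node)
    then show "poly S z = poly (\<Sum>n=1..N. smult (poly S (x n)) (lagrange_poly N x n)) z"
      using l by (simp add: poly_sum)
  next
    have "degree (\<Sum>n=1..N. smult (poly S (x n)) (lagrange_poly N x n)) \<le> N - 1"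
    proof (intro degree_sum_le)
      fix n assume "n \<in> {1..N}"
      from degree_lagrange_poly[OF this, of x]
      show "degree (smult (poly S (x n)) (lagrange_poly N x n)) \<le> N - 1"
        by (intro order.trans[OF degree_smult_le]) simp
    qed auto
    then show "degree (\<Sum>n=1..N. smult (poly S (x n)) (lagrange_poly N x n)) < card (x ` {1..N})"
      using N inj by (simp add: card_image)
  qed (use S inj in \<open>simp add: card_image\<close>)
  then have "poly S = poly (\<Sum>n=1..N. smult (poly S (x n)) (lagrange_poly N x n))"
    by (rule arg_cong)
  also have "\<dots> = (\<lambda>t. \<Sum>n=1..N. poly S (x n) * poly (lagrange_poly N x n) t)"
    by (simp add: fun_eq_iff poly_sum)
  finally have "integral {a..b} (poly S) =
      integral {a..b} (\<lambda>t. \<Sum>n=1..N. poly S (x n) * poly (lagrange_poly N x n) t)"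
    by (rule arg_cong)
  also have "\<dots> = (\<Sum>n=1..N. w n * poly S (x n))"
    using gauss by (subst integral_sum)
      (auto simp: gauss_weight_eq_integral_lagrange integrable_poly integrable_on_mult_right mult.commute)
  also have "\<dots> = (\<Sum>n=1..N. w n * poly R (x n))"
    using roots by (intro sum.cong) (auto simp: eq)
  finally have "integral {a..b} (poly S) = (\<Sum>n=1..N. w n * poly R (x n))" .
  moreover have "integral {a..b} (\<lambda>t. poly P t * poly Q t + poly S t) =
      integral {a..b} (\<lambda>t. poly P t * poly Q t) + integral {a..b} (poly S)"
    using integrable_poly[of "P * Q" a b] integrable_poly[of S a b]
    by (intro integral_add) simp_all
  moreover have "poly R = (\<lambda>t. poly P t * poly Q t + poly S t)"
    by (simp add: eq fun_eq_iff)
  ultimately show ?thesis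
    using orth[OF Q] by simp
qed

text \<open>The square of the \<open>n\<close>-th Lagrange polynomial has degree below \<open>2 N\<close> and is \<open>1\<close> at the \<open>n\<close>-th node and
  \<open>0\<close> at the others, so by exactness its integral is \<open>w n\<close>.\<close>

lemma gauss_weights_nonneg:
  assumes "N \<ge> 1" "gauss_rule a b N x w" "n \<in> {1..N}"
  shows "0 \<le> w n"
proof -
  let ?L = "lagrange_poly N x n"
  have inj: "inj_on x {1..N}"
    using assms(2) by (simp add: gauss_rule_def)
  have "degree (?L * ?L) < 2 * N"
    using degree_lagrange_poly[OF assms(3), of x] degree_mult_le[of ?L ?L] by linarith
  then have "integral {a..b} (poly (?L * ?L)) = (\<Sum>l=1..N. w l * poly (?L * ?L) (x l))"
    using gauss_exact assms by blast
  also have "\<dots> = (\<Sum>l=1..N. if l = n then w l else 0)"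
    using inj assms(3) by (intro sum.cong) (auto simp: poly_lagrange_poly_node)
  also have "\<dots> = w n"
    using assms(3) by simp
  finally show ?thesis
    using integral_nonneg[OF integrable_poly[of "?L * ?L" a b]] by (simp add: poly_mult [abs_def])
qed

lemma gauss_weights_sum:
  assumes "a < b" "N \<ge> 1" "gauss_rule a b N x w"
  shows "(\<Sum>n=1..N. w n) = b - a"
proof -
  have "poly 1 = (\<lambda>_. 1 :: real)"
    by (simp add: fun_eq_iff)
  then show ?thesis
    using gauss_exact[OF assms(2,3), of 1] assms(1,2) by simp
qed

text \<open>The rule and the integral agree on \<open>R\<close>. Each of them changes by at most \<open>e * (b - a)\<close> when \<open>R\<close> is
  replaced by \<open>g\<close>; for the rule this uses that the weights are nonnegative and sum to \<open>b - a\<close>. The approximation is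
  assumed on the open interval only, because the integrand is not controlled on the
  boundary of the domain.\<close>

lemma gauss_error_le:
  assumes ab: "a < b" and N: "N \<ge> 1" and gauss: "gauss_rule a b N x w"
    and R: "degree R < 2 * N" and g: "g integrable_on {a..b}"
    and approx: "\<And>y. y \<in> {a<..<b} \<Longrightarrow> \<bar>g y - poly R y\<bar> \<le> e"
  shows "\<bar>(\<Sum>n=1..N. w n * g (x n)) - integral {a..b} g\<bar> \<le> 2 * e * (b - a)"
proof -
  have e: "0 \<le> e"
    using approx[of "(a + b) / 2"] ab by (simp add: field_simps)
  have "norm (integral {a..b} (\<lambda>y. g y - poly R y)) \<le> e * measure lborel (cbox a b)"
  proof (rule has_integral_bound_spike_finite[of e "{a, b}"])
    show "((\<lambda>y. g y - poly R y) has_integral integral {a..b} (\<lambda>y. g y - poly R y)) (cbox a b)"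
      using g integrable_poly by (simp add: integrable_integral integrable_diff)
  qed (use e approx in auto)
  then have "\<bar>integral {a..b} g - integral {a..b} (poly R)\<bar> \<le> e * (b - a)"
    using ab g integrable_poly by (simp add: integral_diff)
  moreover have "\<bar>(\<Sum>n=1..N. w n * g (x n)) - (\<Sum>n=1..N. w n * poly R (x n))\<bar> \<le> e * (b - a)"
  proof -
    have "\<bar>\<Sum>n=1..N. w n * (g (x n) - poly R (x n))\<bar> \<le> (\<Sum>n=1..N. w n * e)"
    proof (intro order.trans[OF sum_abs] sum_mono)
      fix n assume "n \<in> {1..N}"
      then show "\<bar>w n * (g (x n) - poly R (x n))\<bar> \<le> w n * e"
        using gauss_weights_nonneg[OF N gauss] approx[OF gauss_points_interior[OF ab N gauss]]
        by (simp add: abs_mult mult_left_mono)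
    qed
    also have "\<dots> = e * (b - a)"
      using gauss_weights_sum[OF ab N gauss] by (simp add: sum_distrib_right [symmetric])
    finally show ?thesis
      by (simp add: right_diff_distrib sum_subtractf)
  qed
  ultimately show ?thesis
    using gauss_exact[OF N gauss R] by linarith
qed


section \<open>Composite Gauss quadrature\<close>

text \<open>Taylor's formula around the midpoint. The functions \<open>diff r\<close> stand for the successive
  derivatives of \<open>diff 0\<close>.\<close>

lemma taylor_poly_approx:
  fixes diff :: "nat \<Rightarrow> real \<Rightarrow> real"
  assumes n: "n \<ge> 1" and u: "u < v" and h: "v - u \<le> h"
    and deriv: "\<And>r y. r < n \<Longrightarrow> y \<in> {u<..<v} \<Longrightarrow> (diff r has_real_derivative diff (Suc r) y) (at y)"
    and M: "\<And>y. y \<in> {u<..<v} \<Longrightarrow> \<bar>diff n y\<bar> \<le> M"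
  shows "\<exists>R. degree R < n \<and> (\<forall>y\<in>{u<..<v}. \<bar>diff 0 y - poly R y\<bar> \<le> M * h ^ n / fact n)"
proof -
  define c where "c = (u + v) / 2"
  define R where "R = (\<Sum>r<n. smult (diff r c / fact r) ([:- c, 1:] ^ r))"
  have c: "c \<in> {u<..<v}"
    using u by (simp add: c_def field_simps)
  have "degree R \<le> n - 1"
    unfolding R_def
  proof (intro degree_sum_le)
    fix r assume "r \<in> {..<n}"
    then show "degree (smult (diff r c / fact r) ([:- c, 1:] ^ r)) \<le> n - 1"
      by (auto intro!: order.trans[OF degree_smult_le] simp: degree_linear_power)
  qed auto
  moreover have "\<bar>diff 0 y - poly R y\<bar> \<le> M * h ^ n / fact n" if y: "y \<in> {u<..<v}" for y
  proof (cases "y = c")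
    case True
    have "poly R c = (\<Sum>r<n. if r = 0 then diff r c else 0)"
      unfolding R_def poly_sum by (intro sum.cong) (auto simp: poly_power)
    then have "poly R y = diff 0 y"
      using n True by simp
    moreover have "0 \<le> M"
      using M[OF y] by linarith
    ultimately show ?thesis
      using u h by simp
  next
    case False
    have "\<forall>r t. r < n \<and> min y c \<le> t \<and> t \<le> max y c \<longrightarrow> DERIV (diff r) t :> diff (Suc r) t"
      using c y by (intro allI impI deriv) (auto simp: min_def max_def split: if_splits)
    from Taylor[OF _ refl this, of c y] n False obtain t
      where t: "if y < c then y < t \<and> t < c else c < t \<and> t < y"
        and eq: "diff 0 y = (\<Sum>r<n. (diff r c / fact r) * (y - c) ^ r) + (diff n t / fact n) * (y - c) ^ n"
      by auto
    have "\<bar>diff n t\<bar> \<le> M"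
      using t c y by (intro M) (auto split: if_splits)
    moreover have "\<bar>y - c\<bar> \<le> h"
      using c y h by (auto simp: abs_le_iff)
    ultimately have "\<bar>diff n t\<bar> * \<bar>y - c\<bar> ^ n \<le> M * h ^ n"
      by (intro mult_mono power_mono) auto
    moreover have "diff 0 y - poly R y = (diff n t / fact n) * (y - c) ^ n"
      using eq by (simp add: R_def poly_sum poly_power)
    ultimately show ?thesis
      by (simp add: abs_mult power_abs divide_right_mono)
  qed
  ultimately show ?thesis
    using n by (intro exI[of _ R]) auto
qed

lemma composite_gauss_mesh:
  assumes "composite_gauss_rule a b h s t N x w"
  shows "i \<le> j \<Longrightarrow> j \<le> s \<Longrightarrow> t i \<le> t j"
proof (induction j)
  case (Suc j)
  show ?case
  proof (cases "i = Suc j")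
    case False
    then have "t i \<le> t j" "t j < t (Suc j)"
      using Suc assms by (auto simp: composite_gauss_rule_def)
    then show ?thesis
      by simp
  qed simp
qed simp

lemma composite_gauss_pieces:
  assumes "composite_gauss_rule a b h s t N x w" "r < s"
  shows "a \<le> t r" "t r < t (Suc r)" "t (Suc r) \<le> b" "t (Suc r) - t r \<le> h"
    "gauss_rule (t r) (t (Suc r)) N (\<lambda>n. x (r * N + n)) (\<lambda>n. w (r * N + n))"
  using assms composite_gauss_mesh[OF assms(1), of 0 r] composite_gauss_mesh[OF assms(1), of "Suc r" s]
  by (auto simp: composite_gauss_rule_def)

lemma composite_index:
  fixes N :: nat
  assumes "j \<in> {1..s * N}"
  obtains r n where "r < s" "n \<in> {1..N}" "j = r * N + n"
proof
  have N: "N \<ge> 1"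
    using assms by (cases "N = 0") simp_all
  show "(j - 1) div N < s"
    using assms N by (subst div_less_iff_less_mult) auto
  show "(j - 1) mod N + 1 \<in> {1..N}"
    using N by (auto simp: Suc_le_eq)
  show "j = (j - 1) div N * N + ((j - 1) mod N + 1)"
    using assms div_mult_mod_eq[of "j - 1" N] by simp
qed

lemma composite_points_interior:
  assumes "N \<ge> 1" "composite_gauss_rule a b h s t N x w" "j \<in> {1..s * N}"
  shows "x j \<in> {a<..<b}"
proof -
  obtain r n where r: "r < s" "n \<in> {1..N}" "j = r * N + n"
    using assms(3) by (rule composite_index)
  note piece = composite_gauss_pieces[OF assms(2) r(1)]
  show ?thesis
    using gauss_points_interior[OF piece(2) assms(1) piece(5) r(2)] piece r(3) by auto
qed

lemma composite_weights_nonneg: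
  assumes "N \<ge> 1" "composite_gauss_rule a b h s t N x w" "j \<in> {1..s * N}"
  shows "0 \<le> w j"
proof -
  obtain r n where r: "r < s" "n \<in> {1..N}" "j = r * N + n"
    using assms(3) by (rule composite_index)
  then show ?thesis
    using gauss_weights_nonneg[OF assms(1) composite_gauss_pieces(5)[OF assms(2) r(1)] r(2)] by simp
qed

lemma sum_atLeastAtMost_add:
  "(\<Sum>j=1..c + N. F j) = (\<Sum>j=1..c. F j) + (\<Sum>n=1..N. F (c + n :: nat) :: 'a :: comm_monoid_add)"
  by (induction N) (simp_all add: add.assoc)

text \<open>Errors proportional to the cell lengths add up to the same multiple of the total length, by
  induction over the cells from the left.\<close>

lemma composite_error_le:
  fixes g :: "real \<Rightarrow> real"
  assumes comp: "composite_gauss_rule a b h s t N x w" and g: "g integrable_on {a..b}"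
    and piece: "\<And>r. r < s \<Longrightarrow>
      \<bar>(\<Sum>n=1..N. w (r * N + n) * g (x (r * N + n))) - integral {t r..t (Suc r)} g\<bar>
        \<le> e * (t (Suc r) - t r)"
  shows "\<bar>(\<Sum>j=1..s * N. w j * g (x j)) - integral {a..b} g\<bar> \<le> e * (b - a)"
proof -
  have ends: "t 0 = a" "t s = b"
    using comp by (auto simp: composite_gauss_rule_def)
  have "\<bar>(\<Sum>j=1..r * N. w j * g (x j)) - integral {a..t r} g\<bar> \<le> e * (t r - a)" if "r \<le> s" for r
    using that
  proof (induction r)
    case (Suc r)
    then have r: "r < s"
      by simp
    note bounds = composite_gauss_pieces[OF comp r]
    have "g integrable_on {a..t (Suc r)}"
      using g bounds by (rule_tac integrable_on_subinterval) auto
    then have "integral {a..t (Suc r)} g = integral {a..t r} g + integral {t r..t (Suc r)} g"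
      using bounds by (intro Henstock_Kurzweil_Integration.integral_combine [symmetric]) auto
    moreover have "(\<Sum>j=1..Suc r * N. w j * g (x j)) =
        (\<Sum>j=1..r * N. w j * g (x j)) + (\<Sum>n=1..N. w (r * N + n) * g (x (r * N + n)))"
      using sum_atLeastAtMost_add[of "\<lambda>j. w j * g (x j)" "r * N" N] by (simp add: add.commute)
    moreover have "e * (t (Suc r) - a) = e * (t r - a) + e * (t (Suc r) - t r)"
      by (simp add: algebra_simps)
    ultimately show ?case
      using Suc.IH r piece[OF r] by linarith
  qed (simp add: ends)
  from this[of s] show ?thesis
    by (simp add: ends)
qed

text \<open>This is the error estimate for the constant function \<open>1\<close>, on which every cell is exact.\<close>

lemma composite_weights_sum:
  assumes "N \<ge> 1" "composite_gauss_rule a b h s t N x w"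
  shows "(\<Sum>j=1..s * N. w j) = b - a"
proof -
  have "a \<le> b"
    using composite_gauss_mesh[OF assms(2), of 0 s] assms(2) by (simp add: composite_gauss_rule_def)
  moreover have "\<bar>(\<Sum>j=1..s * N. w j * 1) - integral {a..b} (\<lambda>_. 1)\<bar> \<le> 0 * (b - a)"
  proof (rule composite_error_le[OF assms(2)])
    fix r assume "r < s"
    from composite_gauss_pieces[OF assms(2) this]
    show "\<bar>(\<Sum>n=1..N. w (r * N + n) * 1) - integral {t r..t (Suc r)} (\<lambda>_. 1)\<bar>
        \<le> 0 * (t (Suc r) - t r)"
      using gauss_weights_sum[OF _ assms(1)] by simp
  qed auto
  ultimately show ?thesis
    by simp
qed

lemma composite_gauss_smooth_error_le:
  fixes diff :: "nat \<Rightarrow> real \<Rightarrow> real"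
  assumes N: "N \<ge> 1" and n: "1 \<le> n" "n \<le> 2 * N"
    and comp: "composite_gauss_rule a b h s t N x w"
    and int: "diff 0 integrable_on {a..b}"
    and deriv: "\<And>r y. r < n \<Longrightarrow> y \<in> {a<..<b} \<Longrightarrow> (diff r has_real_derivative diff (Suc r) y) (at y)"
    and M: "\<And>y. y \<in> {a<..<b} \<Longrightarrow> \<bar>diff n y\<bar> \<le> M"
  shows "\<bar>(\<Sum>j=1..s * N. w j * diff 0 (x j)) - integral {a..b} (diff 0)\<bar>
           \<le> 2 * (M * h ^ n / fact n) * (b - a)"
proof (rule composite_error_le[OF comp int])
  fix r assume "r < s"
  note piece = composite_gauss_pieces[OF comp this]
  have "\<exists>R. degree R < n \<and>
      (\<forall>y\<in>{t r<..<t (Suc r)}. \<bar>diff 0 y - poly R y\<bar> \<le> M * h ^ n / fact n)"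
    using piece by (intro taylor_poly_approx n deriv M) auto
  then obtain R where "degree R < n"
    "\<And>y. y \<in> {t r<..<t (Suc r)} \<Longrightarrow> \<bar>diff 0 y - poly R y\<bar> \<le> M * h ^ n / fact n"
    by blast
  moreover have "diff 0 integrable_on {t r..t (Suc r)}"
    using int piece by (rule_tac integrable_on_subinterval) auto
  ultimately show "\<bar>(\<Sum>i=1..N. w (r * N + i) * diff 0 (x (r * N + i))) -
      integral {t r..t (Suc r)} (diff 0)\<bar> \<le> 2 * (M * h ^ n / fact n) * (t (Suc r) - t r)"
    using n piece by (intro gauss_error_le[OF piece(2) N piece(5)]) auto
qed


section \<open>Tensor products of quadrature rules\<close>

lemma product_sigma_finite_lborel: "product_sigma_finite (\<lambda>_ :: nat. lborel :: real measure)"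
  by (simp add: product_sigma_finite_def sigma_finite_lborel)

lemma emeasure_PiM_open_box:
  assumes "finite I" "\<And>i. i \<in> I \<Longrightarrow> a i < b i"
  shows "emeasure (PiM I (\<lambda>_ :: nat. lborel)) (PiE I (\<lambda>i. {a i<..<b i})) = ennreal (\<Prod>i\<in>I. b i - a i)"
proof -
  interpret product_sigma_finite "\<lambda>_ :: nat. lborel :: real measure"
    by (rule product_sigma_finite_lborel)
  have "emeasure (PiM I (\<lambda>_. lborel)) (PiE I (\<lambda>i. {a i<..<b i})) = (\<Prod>i\<in>I. emeasure lborel {a i<..<b i})"
    using assms(1) by (intro emeasure_PiM) auto
  also have "\<dots> = (\<Prod>i\<in>I. ennreal (b i - a i))"
    using assms(2) by (intro prod.cong refl emeasure_lborel_Ioo) (auto intro: less_imp_le)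
  also have "\<dots> = ennreal (\<Prod>i\<in>I. b i - a i)"
    using assms(2) by (intro prod_ennreal) (auto intro: less_imp_le)
  finally show ?thesis .
qed

text \<open>Functions supported in a bounded box are integrated over all of \<open>\<real>\<^sup>I\<close>, so that the coordinates can be
  handled with the product of Lebesgue measures itself rather than with its restrictions.\<close>

lemma integral_indicator_open_box:
  fixes c :: real
  assumes "finite I" "\<And>i. i \<in> I \<Longrightarrow> a i < b i"
  defines "M \<equiv> PiM I (\<lambda>_ :: nat. lborel)" and "U \<equiv> PiE I (\<lambda>i. {a i<..<b i})"
  shows "integrable M (\<lambda>y. c * indicator U y)"
    and "(\<integral>y. c * indicator U y \<partial>M) = c * (\<Prod>i\<in>I. b i - a i)"
proof -
  have sets: "U \<in> sets M"
    unfolding M_def U_def using assms(1) by (intro sets_PiM_I_finite) auto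
  have meas: "emeasure M U = ennreal (\<Prod>i\<in>I. b i - a i)"
    unfolding M_def U_def using assms(1,2) by (rule emeasure_PiM_open_box)
  show "integrable M (\<lambda>y. c * indicator U y)"
    using sets meas by (intro integrable_mult_right integrable_real_indicator) simp_all
  have "0 \<le> (\<Prod>i\<in>I. b i - a i)"
    using assms(2) by (intro prod_nonneg) (auto intro: less_imp_le)
  then have "measure M U = (\<Prod>i\<in>I. b i - a i)"
    by (simp add: measure_def meas)
  moreover have "U \<inter> space M = U"
    using sets by (rule sets.Int_space_eq2)
  ultimately show "(\<integral>y. c * indicator U y \<partial>M) = c * (\<Prod>i\<in>I. b i - a i)"
    by simp
qed

lemma integrable_of_box_bound:
  fixes f :: "(nat \<Rightarrow> real) \<Rightarrow> real"
  assumes "finite I" "\<And>i. i \<in> I \<Longrightarrow> a i < b i"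
    and "f \<in> borel_measurable (PiM I (\<lambda>_. lborel))"
    and "\<And>y. y \<in> extensional I \<Longrightarrow> \<bar>f y\<bar> \<le> c * indicator (PiE I (\<lambda>i. {a i<..<b i})) y"
  shows "integrable (PiM I (\<lambda>_. lborel)) f"
  using order.trans[OF assms(4) abs_ge_self]
  by (intro Bochner_Integration.integrable_bound[OF integral_indicator_open_box(1)[where c = c, OF assms(1,2)] assms(3)] AE_I2)
     (simp_all add: space_PiM PiE_def)

lemma sum_PiE_insert:
  assumes "i \<notin> I"
  shows "(\<Sum>n\<in>PiE (insert i I) J. h n) = (\<Sum>j\<in>J i. \<Sum>n\<in>PiE I J. h (n(i := j)))"
  unfolding PiE_insert_eq
  by (subst sum.reindex[OF inj_combinator[OF assms]])
     (simp add: sum.cartesian_product case_prod_unfold)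

text \<open>Induction over the set \<open>I\<close> of coordinates. For a new coordinate \<open>i\<close>, Fubini's theorem writes the integral
  as that of \<open>G y = \<integral> f (y(i := t)) dt\<close>. Replacing \<open>G y\<close> by the quadrature sum
  \<open>\<Sum>\<^sub>j w i j * f (y(i := x i j))\<close> costs at most \<open>\<epsilon> * (b i - a i)\<close> at each \<open>y\<close> in the box over \<open>I\<close>. What
  remains is a weighted sum of integrals of the slices \<open>f (y(i := x i j))\<close>, to which
  the induction hypothesis applies; the weights \<open>w i j\<close> are nonnegative and sum to \<open>b i - a i\<close>, so the earlier errors
  enter with exactly this factor.\<close>

lemma tensor_quadrature_error_le:
  fixes f :: "(nat \<Rightarrow> real) \<Rightarrow> real" and a b :: "nat \<Rightarrow> real" and x w :: "nat \<Rightarrow> 'j \<Rightarrow> real"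
  defines "U \<equiv> \<lambda>I. PiE I (\<lambda>i. {a i<..<b i})"
  assumes "finite I"
    and "\<And>i. i \<in> I \<Longrightarrow> a i < b i"
    and "\<And>i. i \<in> I \<Longrightarrow> finite (J i)"
    and "\<And>i j. i \<in> I \<Longrightarrow> j \<in> J i \<Longrightarrow> x i j \<in> {a i<..<b i}"
    and "\<And>i j. i \<in> I \<Longrightarrow> j \<in> J i \<Longrightarrow> 0 \<le> w i j"
    and "\<And>i. i \<in> I \<Longrightarrow> (\<Sum>j\<in>J i. w i j) = b i - a i"
    and "f \<in> borel_measurable (PiM I (\<lambda>_. lborel))"
    and "\<And>y. y \<in> extensional I \<Longrightarrow> \<bar>f y\<bar> \<le> c * indicator (U I) y"
    and "\<And>i y. i \<in> I \<Longrightarrow> y \<in> U I \<Longrightarrow>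
      \<bar>(\<Sum>j\<in>J i. w i j * f (y(i := x i j))) - (\<integral>t. f (y(i := t)) \<partial>lborel)\<bar> \<le> \<epsilon> * (b i - a i)"
  shows "\<bar>(\<Sum>n\<in>PiE I J. (\<Prod>i\<in>I. w i (n i)) * f (\<lambda>i\<in>I. x i (n i)))
            - (\<integral>y. f y \<partial>PiM I (\<lambda>_. lborel))\<bar>
           \<le> real (card I) * \<epsilon> * (\<Prod>i\<in>I. b i - a i)"
  using assms(2-)
proof (induction I arbitrary: f rule: finite_induct)
  case empty
  have "(\<integral>y. f y \<partial>PiM {} (\<lambda>_. lborel)) = f (\<lambda>_. undefined)"
    by (simp add: PiM_empty lebesgue_integral_count_space_finite)
  then show ?case
    by (simp add: restrict_def)
next
  case (insert i I)
  interpret product_sigma_finite "\<lambda>_ :: nat. lborel :: real measure"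
    by (rule product_sigma_finite_lborel)
  let ?M = "PiM I (\<lambda>_. lborel :: real measure)"
  let ?V = "\<Prod>k\<in>I. b k - a k"
  note ab = insert.prems(1) and fin = insert.prems(2) and nodes = insert.prems(3)
    and nonneg = insert.prems(4) and weights = insert.prems(5) and meas = insert.prems(6)
    and bound = insert.prems(7) and err = insert.prems(8)
  have i: "a i < b i" "finite (J i)"
    using ab fin by auto
  have V: "0 \<le> ?V"
    using ab by (intro prod_nonneg) (auto intro: less_imp_le)
  have upd_U: "y(i := t) \<in> U (insert i I) \<longleftrightarrow> y \<in> U I \<and> t \<in> {a i<..<b i}"
    if "y \<in> extensional I" for y t
    using that insert.hyps by (auto simp: U_def PiE_def extensional_def Pi_def)
  have upd_ext: "y(i := t) \<in> extensional (insert i I)" if "y \<in> extensional I" for y t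
    using that by (auto simp: extensional_def)
  have U_ext: "y \<in> extensional I" if "y \<in> U I" for y
    using that by (simp add: U_def PiE_def)

  \<comment> \<open>Freezing the new coordinate at a node yields a function to which the induction hypothesis applies.\<close>
  define S where "S j = (\<Sum>n\<in>PiE I J. (\<Prod>k\<in>I. w k (n k)) * f ((\<lambda>k\<in>I. x k (n k))(i := x i j)))" for j
  have slice_meas: "(\<lambda>y. f (y(i := x i j))) \<in> borel_measurable ?M" for j
    using meas by (rule measurable_compose[rotated]) (rule measurable_fun_upd[where J = I], auto)
  have slice_bound: "\<bar>f (y(i := x i j))\<bar> \<le> c * indicator (U I) y"
    if "j \<in> J i" "y \<in> extensional I" for y j
  proof -
    have "\<bar>f (y(i := x i j))\<bar> \<le> c * indicator (U (insert i I)) (y(i := x i j))"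
      using that(2) by (intro bound upd_ext)
    moreover have "y(i := x i j) \<in> U (insert i I) \<longleftrightarrow> y \<in> U I"
      using upd_U[OF that(2)] nodes that(1) by blast
    ultimately show ?thesis
      by (simp only: indicator_def)
  qed
  have slice_int: "integrable ?M (\<lambda>y. f (y(i := x i j)))" if "j \<in> J i" for j
    using insert.hyps(1) ab slice_meas slice_bound that
    by (intro integrable_of_box_bound[where a = a and b = b and c = c]) (auto simp: U_def)
  have slice: "\<bar>S j - (\<integral>y. f (y(i := x i j)) \<partial>?M)\<bar> \<le> real (card I) * \<epsilon> * ?V" if j: "j \<in> J i" for j
    unfolding S_def
  proof (rule insert.IH)
    show "(\<lambda>y. f (y(i := x i j))) \<in> borel_measurable ?M"
      by (rule slice_meas)
    show "\<bar>f (y(i := x i j))\<bar> \<le> c * indicator (U I) y" if "y \<in> extensional I" for y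
      using j that by (rule slice_bound)
  next
    fix k y assume k: "k \<in> I" and y: "y \<in> U I"
    have "i \<noteq> k"
      using k insert.hyps by auto
    then have twist: "(y(k := t))(i := x i j) = (y(i := x i j))(k := t)" for t
      by (rule fun_upd_twist[symmetric])
    have "y(i := x i j) \<in> U (insert i I)"
      using upd_U[OF U_ext[OF y]] y nodes j by blast
    then have "\<bar>(\<Sum>l\<in>J k. w k l * f ((y(i := x i j))(k := x k l)))
        - (\<integral>t. f ((y(i := x i j))(k := t)) \<partial>lborel)\<bar> \<le> \<epsilon> * (b k - a k)"
      by (rule err[OF insertI2[OF k]])
    then show "\<bar>(\<Sum>l\<in>J k. w k l * f ((y(k := x k l))(i := x i j)))
        - (\<integral>t. f ((y(k := t))(i := x i j)) \<partial>lborel)\<bar> \<le> \<epsilon> * (b k - a k)"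
      by (simp only: twist)
  qed (use ab fin nodes nonneg weights in simp_all)

  \<comment> \<open>Integrating out the new coordinate first leaves a one-dimensional quadrature error.\<close>
  define G where "G y = (\<integral>t. f (y(i := t)) \<partial>lborel)" for y
  have outer: "(\<integral>y. f y \<partial>PiM (insert i I) (\<lambda>_. lborel)) = (\<integral>y. G y \<partial>?M)"
    unfolding G_def using insert.hyps ab meas bound
    by (intro product_integral_insert integrable_of_box_bound[where a = a and b = b and c = c])
       (auto simp: U_def)
  have G_meas: "G \<in> borel_measurable ?M"
    unfolding G_def
  proof (rule lborel.borel_measurable_lebesgue_integral)
    have "(\<lambda>z. f ((\<lambda>(y, t). y(i := t)) z)) \<in> borel_measurable (?M \<Otimes>\<^sub>M lborel)"
      by (rule measurable_compose[OF measurable_add_dim meas])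
    then show "(\<lambda>(y, t). f (y(i := t))) \<in> borel_measurable (?M \<Otimes>\<^sub>M lborel)"
      by (simp add: case_prod_unfold)
  qed
  define E where "E y = (\<Sum>j\<in>J i. w i j * f (y(i := x i j))) - G y" for y
  have E_bound: "\<bar>E y\<bar> \<le> \<epsilon> * (b i - a i) * indicator (U I) y" if y: "y \<in> extensional I" for y
  proof (cases "y \<in> U I")
    case True
    define y' where "y' = y(i := (a i + b i) / 2)"
    have "y' \<in> U (insert i I)"
      unfolding y'_def using True i by (subst upd_U[OF y]) (auto simp: field_simps)
    then have "\<bar>(\<Sum>j\<in>J i. w i j * f (y'(i := x i j))) - (\<integral>t. f (y'(i := t)) \<partial>lborel)\<bar>
        \<le> \<epsilon> * (b i - a i)"
      by (rule err[OF insertI1])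
    with True show ?thesis
      by (simp only: E_def G_def y'_def fun_upd_upd indicator_simps mult_1_right)
  next
    case False
    have "f (y(i := t)) = 0" for t
    proof -
      have "y(i := t) \<notin> U (insert i I)"
        using False upd_U[OF y] by blast
      moreover have "\<bar>f (y(i := t))\<bar> \<le> c * indicator (U (insert i I)) (y(i := t))"
        using y by (intro bound upd_ext)
      ultimately show ?thesis
        by (simp only: indicator_simps simp_thms mult_zero_right abs_le_zero_iff)
    qed
    with False show ?thesis
      by (simp add: E_def G_def)
  qed
  have E_int: "integrable ?M E"
  proof (rule integrable_of_box_bound[where a = a and b = b])
    show "E \<in> borel_measurable ?M"
      unfolding E_def using slice_meas G_meas by measurable
    show "\<bar>E y\<bar> \<le> \<epsilon> * (b i - a i) * indicator (PiE I (\<lambda>i. {a i<..<b i})) y"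
      if "y \<in> extensional I" for y
      using E_bound[OF that] by (simp add: U_def)
  qed (use insert.hyps ab in auto)
  have E_integral: "\<bar>\<integral>y. E y \<partial>?M\<bar> \<le> \<epsilon> * (b i - a i) * ?V"
  proof -
    have "\<bar>\<integral>y. E y \<partial>?M\<bar> \<le> (\<integral>y. \<epsilon> * (b i - a i) * indicator (U I) y \<partial>?M)"
      using E_bound insert.hyps ab E_int unfolding U_def
      by (intro order.trans[OF integral_abs_bound] integral_mono integrable_abs
          integral_indicator_open_box(1)) (auto simp: space_PiM PiE_def)
    also have "\<dots> = \<epsilon> * (b i - a i) * ?V"
      unfolding U_def using insert.hyps ab by (intro integral_indicator_open_box(2)) auto
    finally show ?thesis .
  qed
  have "(\<integral>y. G y \<partial>?M) = (\<integral>y. (\<Sum>j\<in>J i. w i j * f (y(i := x i j))) - E y \<partial>?M)"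
    by (simp add: E_def)
  also have "\<dots> = (\<Sum>j\<in>J i. w i j * (\<integral>y. f (y(i := x i j)) \<partial>?M)) - (\<integral>y. E y \<partial>?M)"
    using slice_int E_int by (simp add: Bochner_Integration.integral_sum)
  finally have integral: "(\<integral>y. f y \<partial>PiM (insert i I) (\<lambda>_. lborel)) =
      (\<Sum>j\<in>J i. w i j * (\<integral>y. f (y(i := x i j)) \<partial>?M)) - (\<integral>y. E y \<partial>?M)"
    by (simp only: outer)
  have quadrature: "(\<Sum>n\<in>PiE (insert i I) J. (\<Prod>k\<in>insert i I. w k (n k)) *
      f (\<lambda>k\<in>insert i I. x k (n k))) = (\<Sum>j\<in>J i. w i j * S j)"
  proof -
    have "(\<Prod>k\<in>insert i I. w k ((n(i := j)) k)) = w i j * (\<Prod>k\<in>I. w k (n k))" for n j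
      using insert.hyps by (auto intro!: prod.cong)
    moreover have "(\<lambda>k\<in>insert i I. x k ((n(i := j)) k)) = (\<lambda>k\<in>I. x k (n k))(i := x i j)" for n j
      using insert.hyps by (auto simp: fun_eq_iff)
    ultimately show ?thesis
      unfolding S_def by (simp only: sum_PiE_insert[OF insert.hyps(2)] sum_distrib_left mult.assoc)
  qed
  have "\<bar>\<Sum>j\<in>J i. w i j * (S j - (\<integral>y. f (y(i := x i j)) \<partial>?M))\<bar>
      \<le> (\<Sum>j\<in>J i. w i j * (real (card I) * \<epsilon> * ?V))"
    using slice nonneg
    by (intro order.trans[OF sum_abs] sum_mono) (auto simp: abs_mult intro: mult_left_mono)
  also have "\<dots> = (b i - a i) * (real (card I) * \<epsilon> * ?V)"
    using weights by (simp add: sum_distrib_right [symmetric])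
  finally have "\<bar>(\<Sum>j\<in>J i. w i j * S j) - (\<Sum>j\<in>J i. w i j * (\<integral>y. f (y(i := x i j)) \<partial>?M))\<bar>
      \<le> (b i - a i) * (real (card I) * \<epsilon> * ?V)"
    by (simp add: right_diff_distrib sum_subtractf)
  moreover have "real (card (insert i I)) * \<epsilon> * (\<Prod>k\<in>insert i I. b k - a k) =
      (b i - a i) * (real (card I) * \<epsilon> * ?V) + \<epsilon> * (b i - a i) * ?V"
    using insert.hyps by (simp add: algebra_simps)
  ultimately show ?case
    using E_integral unfolding integral quadrature by linarith
qed


section \<open>From the open box to the given domain\<close>

text \<open>The measurability of \<open>g\<close> is part of the conclusion: in a complete measure space a function
  that agrees almost everywhere with a measurable one is measurable. The integrand restricted to the given box may
  behave arbitrarily on the boundary, and this is what allows to discard it.\<close>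

lemma integral_completion_cong_AE:
  fixes f g :: "'a \<Rightarrow> real"
  assumes f: "f \<in> borel_measurable M" and AE: "AE y in M. g y = f y"
  shows "(\<integral>y. g y \<partial>completion M) = (\<integral>y. f y \<partial>M)"
proof -
  have AE': "AE y in completion M. g y = f y"
    using AE by (rule AE_completion)
  have f': "f \<in> borel_measurable (completion M)"
    using f by (rule measurable_completion)
  have "g \<in> borel_measurable (completion M)"
  proof (rule measurableI)
    fix A :: "real set" assume A: "A \<in> sets borel"
    show "g -` A \<inter> space (completion M) \<in> sets (completion M)"
    proof (rule completion.in_sets_AE)
      show "AE y in completion M. y \<in> f -` A \<inter> space (completion M) \<longleftrightarrow> y \<in> g -` A \<inter> space (completion M)"
        using AE' by eventually_elim auto
    qed (use measurable_sets[OF f' A] in auto)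
  qed auto
  then have "(\<integral>y. g y \<partial>completion M) = (\<integral>y. f y \<partial>completion M)"
    using f' AE' by (rule integral_cong_AE)
  with f show ?thesis
    by (simp add: integral_completion)
qed

lemma AE_PiM_lborel_coordinate_neq:
  assumes "finite I" "i \<in> I"
  shows "AE y in PiM I (\<lambda>_ :: nat. lborel :: real measure). y i \<noteq> c"
proof (rule AE_I')
  interpret product_sigma_finite "\<lambda>_ :: nat. lborel :: real measure"
    by (rule product_sigma_finite_lborel)
  let ?A = "PiE I (\<lambda>k. if k = i then {c} else (UNIV :: real set))"
  have "emeasure (PiM I (\<lambda>_. lborel)) ?A =
      (\<Prod>k\<in>I. emeasure lborel (if k = i then {c} else (UNIV :: real set)))"
    using assms by (intro emeasure_PiM) auto
  also have "\<dots> = 0"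
    using assms by (intro prod_zero) (auto intro!: bexI[of _ i])
  finally show "?A \<in> null_sets (PiM I (\<lambda>_. lborel))"
    using assms by (intro null_setsI sets_PiM_I_finite) auto
  show "{y \<in> space (PiM I (\<lambda>_. lborel)). \<not> y i \<noteq> c} \<subseteq> ?A"
    by (auto simp: space_PiM PiE_def Pi_def)
qed

lemma bounded_interval_interior:
  fixes S :: "real set"
  assumes "is_interval S" "bounded S" "interior S \<noteq> {}"
  shows "interior S = {Inf S<..<Sup S}" and "S \<subseteq> {Inf S..Sup S}" and "Inf S < Sup S"
proof -
  have ne: "S \<noteq> {}"
    using assms(3) by auto
  have bdd: "bdd_below S" "bdd_above S"
    using assms(2) by (auto simp: bounded_imp_bdd_below bounded_imp_bdd_above)
  show S: "S \<subseteq> {Inf S..Sup S}"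
    using bdd by (auto intro: cInf_lower cSup_upper)
  have "{Inf S<..<Sup S} \<subseteq> S"
  proof
    fix t assume t: "t \<in> {Inf S<..<Sup S}"
    obtain u v where "u \<in> S" "u < t" "v \<in> S" "t < v"
      using t cInf_less_iff[OF ne bdd(1)] less_cSup_iff[OF ne bdd(2)] by auto
    then show "t \<in> S"
      using mem_is_interval_1_I[OF assms(1), of u v t] by simp
  qed
  then have "{Inf S<..<Sup S} \<subseteq> interior S"
    by (rule interior_maximal) simp
  moreover have "interior S \<subseteq> {Inf S<..<Sup S}"
    using interior_mono[OF S] by simp
  ultimately show "interior S = {Inf S<..<Sup S}"
    by auto
  with assms(3) show "Inf S < Sup S"
    by auto
qed


section \<open>Accuracy of product Gauss rules\<close>

lemma C_bounded_imp_continuous_bounded: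
  "C_bounded d U n f \<Longrightarrow> continuous_on U f \<and> bounded (f ` U)"
  by (cases n) auto

lemma C_bounded_part_deriv_funpow:
  assumes "i \<in> {1..d}" "r \<le> n" "C_bounded d U n f"
  shows "C_bounded d U (n - r) ((part_deriv i ^^ r) f)"
  using assms(2)
proof (induction r)
  case (Suc r)
  then have "n - r = Suc (n - Suc r)"
    by simp
  with Suc have "C_bounded d U (Suc (n - Suc r)) ((part_deriv i ^^ r) f)"
    by simp
  with assms(1) show ?case
    by simp
qed (use assms(3) in simp)

text \<open>This turns the bound on the derivatives of order \<open>n\<close> into a bound for the one-dimensional
  slices.\<close>

lemma multi_deriv_single_direction:
  assumes "i \<in> {1..d}"
  shows "multi_deriv d ((\<lambda>_. 0)(i := n)) f = (part_deriv i ^^ n) f"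
proof -
  have "distinct ks \<Longrightarrow> foldr (\<lambda>k. part_deriv k ^^ ((\<lambda>_. 0)(i := n)) k) ks f =
      (if i \<in> set ks then (part_deriv i ^^ n) f else f)" for ks
    by (induction ks) auto
  from this[OF distinct_upt] show ?thesis
    using assms unfolding multi_deriv_def by (simp only: set_upt) auto
qed

text \<open>Continuity of \<open>F\<close> refers to the product topology on all functions, measurability to the product
  \<open>\<sigma>\<close>-algebra on extensional ones. The identity is measurable between the two because
  it is so in each coordinate; the coordinates outside \<open>{1..d}\<close> are constant.\<close>

lemma borel_measurable_continuous_on_box:
  fixes F :: "(nat \<Rightarrow> real) \<Rightarrow> real" and d and a b :: "nat \<Rightarrow> real"
  defines "U \<equiv> PiE {1..d} (\<lambda>i. {a i<..<b i})"
  assumes "continuous_on U F"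
  shows "(\<lambda>y. indicator U y * F y) \<in> borel_measurable (PiM {1..d} (\<lambda>_. lborel))"
proof -
  let ?M = "PiM {1..d} (\<lambda>_. lborel :: real measure)"
  have U: "U \<inter> space ?M \<in> sets ?M"
    unfolding U_def by (intro sets.Int sets_PiM_I_finite) auto
  have "(\<lambda>y. y i) \<in> borel_measurable ?M" for i
  proof (cases "i \<in> {1..d}")
    case True
    from measurable_component_singleton[OF this, of "\<lambda>_. lborel"] show ?thesis
      by simp
  next
    case False
    have "(\<lambda>y. y i) \<in> borel_measurable ?M \<longleftrightarrow> (\<lambda>_. undefined :: real) \<in> borel_measurable ?M"
      using False by (intro measurable_cong) (auto simp: space_PiM PiE_def extensional_def)
    then show ?thesis
      by simp
  qed
  then have "(\<lambda>y. y) \<in> measurable ?M borel"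
    by (rule measurable_coordinatewise_then_product)
  then have "(\<lambda>y. y) \<in> measurable (restrict_space ?M U) (restrict_space borel U)"
    by (rule measurable_restrict_space3) auto
  then have "F \<in> borel_measurable (restrict_space ?M U)"
    using borel_measurable_continuous_on_restrict[OF assms(2)] by (rule measurable_compose)
  then show ?thesis
    using U by (simp add: borel_measurable_restrict_space_iff)
qed

lemma composite_gauss_lborel_error_le:
  fixes diff :: "nat \<Rightarrow> real \<Rightarrow> real"
  assumes N: "N \<ge> 1" and n: "1 \<le> n" "n \<le> 2 * N"
    and comp: "composite_gauss_rule a b h s t N x w"
    and deriv: "\<And>r y. r < n \<Longrightarrow> y \<in> {a<..<b} \<Longrightarrow> (diff r has_real_derivative diff (Suc r) y) (at y)"
    and M: "\<And>y. y \<in> {a<..<b} \<Longrightarrow> \<bar>diff n y\<bar> \<le> M"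
    and bounded: "\<And>y. y \<in> {a<..<b} \<Longrightarrow> \<bar>diff 0 y\<bar> \<le> c"
  shows "\<bar>(\<Sum>j=1..s * N. w j * diff 0 (x j)) - (\<integral>y. indicator {a<..<b} y * diff 0 y \<partial>lborel)\<bar>
           \<le> 2 * (M * h ^ n / fact n) * (b - a)"
proof -
  have "continuous_on {a<..<b} (diff 0)"
    using deriv[of 0] n(1) by (intro DERIV_continuous_on[of _ _ "diff 1"]) (auto intro: has_field_derivative_at_within)
  then have "(\<lambda>y. indicator {a<..<b} y *\<^sub>R diff 0 y) \<in> borel_measurable lborel"
    using borel_measurable_continuous_on_indicator[of "{a<..<b}" "diff 0"] by simp
  then have "integrable lborel (\<lambda>y. indicator {a<..<b} y *\<^sub>R diff 0 y)"
  proof (rule Bochner_Integration.integrable_bound[rotated], intro AE_I2)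
    show "norm (indicator {a<..<b} y *\<^sub>R diff 0 y) \<le> norm (c * indicator {a<..<b} y)" for y
      using order.trans[OF bounded abs_ge_self] by (simp add: indicator_def)
    have "emeasure lborel {a<..<b} \<le> emeasure lborel {a..b}"
      by (intro emeasure_mono) auto
    then have "emeasure lborel {a<..<b} < \<infinity>"
      using emeasure_compact_finite[of "{a..b}"] by (auto simp: top.not_eq_extremum)
    then show "integrable lborel (\<lambda>y. c * indicator {a<..<b} y)"
      by (intro integrable_mult_right integrable_real_indicator) simp_all
  qed
  then have int: "set_integrable lborel {a<..<b} (diff 0)"
    by (simp add: set_integrable_def)
  note HK = set_borel_integral_eq_integral[OF int]
  have "diff 0 integrable_on {a..b}"
    using HK(1) by (simp add: integrable_on_open_interval_real)
  from composite_gauss_smooth_error_le[where diff = diff, OF N n comp this deriv M] HK(2) show ?thesis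
    by (simp add: integral_open_interval_real set_lebesgue_integral_def)
qed

text \<open>Along the line through \<open>y\<close> in direction \<open>i\<close>, the successive derivatives of \<open>F\<close> are the iterated partial
  derivatives in direction \<open>i\<close>, and the line meets the box in the interval where the one-dimensional
  estimate applies. The cut-off by the indicator affects neither the nodes, which are interior,
  nor the integral over that interval.\<close>

lemma slice_quadrature_error_le:
  fixes F :: "(nat \<Rightarrow> real) \<Rightarrow> real" and d and a b :: "nat \<Rightarrow> real"
  defines "U \<equiv> PiE {1..d} (\<lambda>i. {a i<..<b i})"
  defines "f \<equiv> \<lambda>y. indicator U y * F y"
  assumes N: "N \<ge> 1" and n: "1 \<le> n" "n \<le> 2 * N"
    and comp: "composite_gauss_rule (a i) (b i) h s t N x w"
    and F: "C_bounded d U n F"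
    and M: "\<And>\<gamma> y. (\<Sum>i=1..d. \<gamma> i) = n \<Longrightarrow> y \<in> U \<Longrightarrow> \<bar>multi_deriv d \<gamma> F y\<bar> \<le> M"
    and i: "i \<in> {1..d}" and y: "y \<in> U"
  shows "\<bar>(\<Sum>j=1..s * N. w j * f (y(i := x j))) - (\<integral>t. f (y(i := t)) \<partial>lborel)\<bar>
           \<le> 2 * (M * h ^ n / fact n) * (b i - a i)"
proof -
  define diff where "diff r t = (part_deriv i ^^ r) F (y(i := t))" for r t
  have upd: "y(i := t) \<in> U \<longleftrightarrow> t \<in> {a i<..<b i}" for t
    using i y by (auto simp: U_def PiE_def Pi_def extensional_def)
  have f: "f (y(i := t)) = indicator {a i<..<b i} t * diff 0 t" for t
    using upd[of t] by (simp only: f_def diff_def indicator_def funpow_0)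
  obtain c where c: "\<And>z. z \<in> U \<Longrightarrow> \<bar>F z\<bar> \<le> c"
    using C_bounded_imp_continuous_bounded[OF F] by (auto simp: bounded_iff)
  have deriv: "(diff r has_real_derivative diff (Suc r) t) (at t)"
    if r: "r < n" and t: "t \<in> {a i<..<b i}" for r t
  proof -
    have "C_bounded d U (Suc (n - Suc r)) ((part_deriv i ^^ r) F)"
      using C_bounded_part_deriv_funpow[OF i _ F, of r] r by (simp add: Suc_diff_Suc)
    then have "(\<lambda>u. (part_deriv i ^^ r) F ((y(i := t))(i := u))) field_differentiable at ((y(i := t)) i)"
      using upd[of t] t i unfolding C_bounded.simps by blast
    then have "diff r field_differentiable at t"
      by (simp only: fun_upd_upd fun_upd_same diff_def [abs_def])
    moreover have "diff (Suc r) t = deriv (diff r) t"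
      by (simp only: diff_def [abs_def] funpow.simps o_apply part_deriv_def fun_upd_upd fun_upd_same)
    ultimately show ?thesis
      using field_differentiable_derivI by metis
  qed
  have top: "\<bar>diff n t\<bar> \<le> M" if "t \<in> {a i<..<b i}" for t
  proof -
    have "(\<Sum>k=1..d. ((\<lambda>_. 0)(i := n)) k) = n"
      using i by (simp add: sum.delta)
    from M[OF this, of "y(i := t)"] show ?thesis
      using that upd unfolding multi_deriv_single_direction[OF i] diff_def by blast
  qed
  have "\<bar>(\<Sum>j=1..s * N. w j * diff 0 (x j)) - (\<integral>t. indicator {a i<..<b i} t * diff 0 t \<partial>lborel)\<bar>
      \<le> 2 * (M * h ^ n / fact n) * (b i - a i)"
    using c upd by (intro composite_gauss_lborel_error_le[OF N n comp deriv top, where c = c]) (auto simp: diff_def)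
  moreover have "(\<Sum>j=1..s * N. w j * diff 0 (x j)) = (\<Sum>j=1..s * N. w j * f (y(i := x j)))"
    using composite_points_interior[OF N comp] by (intro sum.cong) (auto simp: f)
  ultimately show ?thesis
    by (simp only: f)
qed

text \<open>Both boxes differ only in points with some coordinate \<open>y i \<in> {a i, b i}\<close>.\<close>

lemma box_integral_eq_interior_box_integral:
  fixes F :: "(nat \<Rightarrow> real) \<Rightarrow> real"
  assumes "\<And>i. i \<in> {1..d} \<Longrightarrow> {a i<..<b i} \<subseteq> \<Omega> i \<and> \<Omega> i \<subseteq> {a i..b i}"
  defines "U \<equiv> PiE {1..d} (\<lambda>i. {a i<..<b i})"
  assumes "continuous_on U F"
  shows "(LINT y:box_of d \<Omega>|lebesgue_pow d. F y) =
         (\<integral>y. indicator U y * F y \<partial>PiM {1..d} (\<lambda>_. lborel))"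
proof -
  let ?M = "PiM {1..d} (\<lambda>_. lborel :: real measure)"
  have "AE y in ?M. \<forall>i\<in>{1..d}. y i \<noteq> a i \<and> y i \<noteq> b i"
    by (intro AE_finite_allI AE_conjI AE_PiM_lborel_coordinate_neq) auto
  then have "AE y in ?M. indicator (box_of d \<Omega>) y * F y = indicator U y * F y"
  proof eventually_elim
    case (elim y)
    have "y i \<in> \<Omega> i \<longleftrightarrow> y i \<in> {a i<..<b i}" if "i \<in> {1..d}" for i
      using elim assms(1)[OF that] that by force
    then have "y \<in> box_of d \<Omega> \<longleftrightarrow> y \<in> U"
      by (simp add: box_of_def U_def PiE_def Pi_def)
    then show ?case
      by (simp add: indicator_def)
  qed
  with assms(3) have "(\<integral>y. indicator (box_of d \<Omega>) y * F y \<partial>completion ?M) =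
      (\<integral>y. indicator U y * F y \<partial>?M)"
    unfolding U_def by (intro integral_completion_cong_AE borel_measurable_continuous_on_box)
  then show ?thesis
    by (simp add: set_lebesgue_integral_def lebesgue_pow_def)
qed

lemma product_gauss_error_le:
  fixes F :: "(nat \<Rightarrow> real) \<Rightarrow> real"
  assumes \<Omega>: "\<And>i. i \<in> {1..d} \<Longrightarrow> is_interval (\<Omega> i) \<and> bounded (\<Omega> i) \<and> interior (\<Omega> i) \<noteq> {}"
  defines "U \<equiv> box_of d (\<lambda>i. interior (\<Omega> i))"
  assumes n: "1 \<le> n" "\<And>i. i \<in> {1..d} \<Longrightarrow> N i \<ge> 1 \<and> n \<le> 2 * N i"
    and comp: "\<And>i. i \<in> {1..d} \<Longrightarrow>
      composite_gauss_rule (Inf (\<Omega> i)) (Sup (\<Omega> i)) h (s i) (t i) (N i) (x i) (w i)"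
    and F: "C_bounded d U n F"
    and M: "\<And>\<gamma> y. (\<Sum>i=1..d. \<gamma> i) = n \<Longrightarrow> y \<in> U \<Longrightarrow> \<bar>multi_deriv d \<gamma> F y\<bar> \<le> M"
  shows "\<bar>(\<Sum>k\<in>PiE {1..d} (\<lambda>i. {1..s i * N i}). (\<Prod>i=1..d. w i (k i)) * F (\<lambda>i\<in>{1..d}. x i (k i)))
            - (LINT y:box_of d \<Omega>|lebesgue_pow d. F y)\<bar>
           \<le> real d * (2 * (M * h ^ n / fact n)) * (\<Prod>i=1..d. Sup (\<Omega> i) - Inf (\<Omega> i))"
proof -
  define a b where "a i = Inf (\<Omega> i)" and "b i = Sup (\<Omega> i)" for i
  define V where "V = PiE {1..d} (\<lambda>i. {a i<..<b i})"
  define f where "f y = indicator V y * F y" for y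
  let ?J = "\<lambda>i. {1..s i * N i}"
  have \<Omega>': "interior (\<Omega> i) = {a i<..<b i}" "\<Omega> i \<subseteq> {a i..b i}" "a i < b i" if "i \<in> {1..d}" for i
    using bounded_interval_interior[of "\<Omega> i"] \<Omega>[OF that] by (simp_all add: a_def b_def)
  have UV: "U = V"
    unfolding U_def V_def box_of_def using \<Omega>'(1) by (intro PiE_cong) auto
  have cont: "continuous_on V F"
    using C_bounded_imp_continuous_bounded[OF F] by (simp add: UV)
  obtain c where c: "\<And>z. z \<in> V \<Longrightarrow> \<bar>F z\<bar> \<le> c"
    using C_bounded_imp_continuous_bounded[OF F] by (auto simp: bounded_iff UV)
  have sets: "{a i<..<b i} \<subseteq> \<Omega> i \<and> \<Omega> i \<subseteq> {a i..b i}" if "i \<in> {1..d}" for i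
    using \<Omega>'[OF that] interior_subset[of "\<Omega> i"] by simp
  have comp': "composite_gauss_rule (a i) (b i) h (s i) (t i) (N i) (x i) (w i)"
    if "i \<in> {1..d}" for i
    using comp[OF that] by (simp add: a_def b_def)
  have "\<bar>(\<Sum>k\<in>PiE {1..d} ?J. (\<Prod>i\<in>{1..d}. w i (k i)) * f (\<lambda>i\<in>{1..d}. x i (k i)))
          - (\<integral>y. f y \<partial>PiM {1..d} (\<lambda>_. lborel))\<bar>
      \<le> real (card {1..d}) * (2 * (M * h ^ n / fact n)) * (\<Prod>i\<in>{1..d}. b i - a i)"
  proof (rule tensor_quadrature_error_le)
    show "f \<in> borel_measurable (PiM {1..d} (\<lambda>_. lborel))"
      unfolding f_def V_def using cont by (intro borel_measurable_continuous_on_box) (simp add: V_def)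
    show "\<bar>f y\<bar> \<le> c * indicator (PiE {1..d} (\<lambda>i. {a i<..<b i})) y" for y
      unfolding V_def [symmetric] using c by (simp add: f_def indicator_def)
  next
    fix i y assume i: "i \<in> {1..d}" and y: "y \<in> PiE {1..d} (\<lambda>i. {a i<..<b i})"
    show "\<bar>(\<Sum>j=1..s i * N i. w i j * f (y(i := x i j))) - (\<integral>t. f (y(i := t)) \<partial>lborel)\<bar>
        \<le> 2 * (M * h ^ n / fact n) * (b i - a i)"
      unfolding f_def V_def
      by (rule slice_quadrature_error_le[OF _ _ _ comp'[OF i] _ _ i y])
         (use n i F M in \<open>simp_all add: UV V_def\<close>)
  next
    fix i assume i: "i \<in> {1..d}"
    note rule = conjunct1[OF n(2)[OF i]] comp'[OF i]
    show "a i < b i" "finite (?J i)"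
      using \<Omega>'(3)[OF i] by simp_all
    show "(\<Sum>j\<in>?J i. w i j) = b i - a i"
      by (rule composite_weights_sum[OF rule])
    fix j assume j: "j \<in> ?J i"
    show "x i j \<in> {a i<..<b i}"
      by (rule composite_points_interior[OF rule j])
    show "0 \<le> w i j"
      by (rule composite_weights_nonneg[OF rule j])
  qed simp
  moreover have "f (\<lambda>i\<in>{1..d}. x i (k i)) = F (\<lambda>i\<in>{1..d}. x i (k i))" if k: "k \<in> PiE {1..d} ?J" for k
  proof -
    have "x i (k i) \<in> {a i<..<b i}" if "i \<in> {1..d}" for i
      by (rule composite_points_interior[OF conjunct1[OF n(2)[OF that]] comp'[OF that] PiE_mem[OF k that]])
    then have "(\<lambda>i\<in>{1..d}. x i (k i)) \<in> V"
      unfolding V_def by (intro restrict_PiE_iff [THEN iffD2]) blast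
    then show ?thesis
      by (simp add: f_def)
  qed
  moreover have "(LINT y:box_of d \<Omega>|lebesgue_pow d. F y) = (\<integral>y. f y \<partial>PiM {1..d} (\<lambda>_. lborel))"
    unfolding f_def V_def
    by (rule box_integral_eq_interior_box_integral) (use sets cont in \<open>simp_all add: V_def\<close>)
  ultimately show ?thesis
    by (simp add: a_def b_def)
qed


section \<open>The splitting scheme\<close>

lemma direct_scheme_eq_quadrature_of_integrand:
  "direct_scheme d p q m k net B N x w =
     (\<Sum>n\<in>PiE {1..d} (\<lambda>i. {1..N i}). (\<Prod>i=1..d. w i (n i)) *
        integrand d p q m k net B (\<lambda>i\<in>{1..d}. x i (n i)))"
proof -
  have "(\<Prod>\<beta>\<in>idx_B d m. c \<beta> ^ \<alpha> \<beta>) = (\<Prod>\<beta>\<in>idx_B_of d m \<alpha>. c \<beta> ^ \<alpha> \<beta>)" for c :: "_ \<Rightarrow> real" and \<alpha>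
    by (rule prod.mono_neutral_right) (auto simp: idx_B_of_def finite_idx_B not_less_eq_eq)
  moreover have "coeff_A d q B \<alpha> (\<lambda>i\<in>{1..d}. x i (n i)) = (\<Sum>l=1..q. \<Prod>i=1..d. B i l \<alpha> (x i (n i)))"
    for \<alpha> n
    by (simp add: coeff_A_def)
  ultimately show ?thesis
    by (simp only: direct_scheme_def integrand_def)
qed

text \<open>The scheme equals the product Gauss rule applied to the integrand. Every \<open>N i\<close> is at least the
  minimum \<open>n / 2\<close>, so the rule in each direction is exact on the Taylor polynomials of degree \<open>n - 1\<close>.\<close>

lemma splitting_scheme_error_le:
  fixes d p q m k net B and \<Omega> :: "nat \<Rightarrow> real set" and N :: "nat \<Rightarrow> nat"
  assumes "d \<ge> 1"
    and \<Omega>: "\<forall>i\<in>{1..d}. is_interval (\<Omega> i) \<and> bounded (\<Omega> i) \<and> interior (\<Omega> i) \<noteq> {}"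
    and net: "\<forall>i\<in>{1..d}. smooth_subnetwork p m (net i)"
  defines "F \<equiv> integrand d p q m k net B" and "U \<equiv> box_of d (\<lambda>i. interior (\<Omega> i))"
    and "n \<equiv> 2 * Min (N ` {1..d})"
  assumes comp: "\<forall>i\<in>{1..d}. N i \<ge> 1 \<and>
      composite_gauss_rule (Inf (\<Omega> i)) (Sup (\<Omega> i)) h (s i) (t i) (N i) (x i) (w i)"
    and F: "C_bounded d U n F"
    and M: "\<forall>\<gamma>. (\<Sum>i=1..d. \<gamma> i) = n \<longrightarrow> (\<forall>y\<in>U. \<bar>multi_deriv d \<gamma> F y\<bar> \<le> M)"
  shows "\<bar>splitting_scheme d p q m k net B (\<lambda>i. s i * N i) x w
            - (LINT y:box_of d \<Omega>|lebesgue_pow d. F y)\<bar>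
           \<le> 2 * real d * (\<Prod>i=1..d. Sup (\<Omega> i) - Inf (\<Omega> i)) * M * (h ^ n / fact n)"
proof -
  have "Min (N ` {1..d}) \<in> N ` {1..d}"
    using assms(1) by (intro Min_in) auto
  then have n1: "1 \<le> n"
    using comp by (auto simp: n_def)
  have n2: "N i \<ge> 1 \<and> n \<le> 2 * N i" if "i \<in> {1..d}" for i
    using comp that by (simp add: n_def)
  have "splitting_scheme d p q m k net B (\<lambda>i. s i * N i) x w =
      (\<Sum>k\<in>PiE {1..d} (\<lambda>i. {1..s i * N i}). (\<Prod>i=1..d. w i (k i)) * F (\<lambda>i\<in>{1..d}. x i (k i)))"
    unfolding splitting_eq_direct[OF net] direct_scheme_eq_quadrature_of_integrand F_def ..
  moreover have "\<bar>(\<Sum>k\<in>PiE {1..d} (\<lambda>i. {1..s i * N i}). (\<Prod>i=1..d. w i (k i)) * F (\<lambda>i\<in>{1..d}. x i (k i)))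
            - (LINT y:box_of d \<Omega>|lebesgue_pow d. F y)\<bar>
      \<le> real d * (2 * (M * h ^ n / fact n)) * (\<Prod>i=1..d. Sup (\<Omega> i) - Inf (\<Omega> i))"
    by (rule product_gauss_error_le[where \<Omega> = \<Omega> and N = N and s = s and t = t, OF _ n1 n2])
       (use \<Omega> comp F M in \<open>auto simp: U_def\<close>)
  ultimately show ?thesis
    by (simp add: mult_ac)
qed

theorem theorem3:
  shows "(\<exists>C::real. \<forall>(d::nat) (p::nat) (q::nat) (m::nat) (k::nat)
            (\<Omega> :: nat \<Rightarrow> real set) (net :: nat \<Rightarrow> layer list) (B :: coeffs).
      d \<ge> 1 \<and> p \<ge> 1 \<and> q \<ge> 1 \<and> m \<ge> 1 \<and> k \<ge> 1 \<and>
      (\<forall>i\<in>{1..d}. is_interval (\<Omega> i) \<and> bounded (\<Omega> i) \<and> interior (\<Omega> i) \<noteq> {}) \<and>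
      (\<forall>i\<in>{1..d}. smooth_subnetwork p m (net i)) \<and>
      (\<forall>i\<in>{1..d}. \<forall>l\<in>{1..q}. \<forall>\<alpha>\<in>idx_A d m k. in_L2 (\<Omega> i) (B i l \<alpha>)) \<longrightarrow>
      \<comment> \<open>equivalence and complexity\<close>
      (\<forall>(N :: nat \<Rightarrow> nat) (x :: nat \<Rightarrow> nat \<Rightarrow> real) (w :: nat \<Rightarrow> nat \<Rightarrow> real).
         (\<forall>i\<in>{1..d}. N i \<ge> 1 \<and> gauss_rule (Inf (\<Omega> i)) (Sup (\<Omega> i)) (N i) (x i) (w i)) \<longrightarrow>
         splitting_scheme d p q m k net B N x w = direct_scheme d p q m k net B N x w \<and>
         prog_val (splitting_prog d p q m k net B N x w) = splitting_scheme d p q m k net B N x w \<and>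
         (\<forall>T\<^sub>1\<ge>1. prog_cost T\<^sub>1 (splitting_prog d p q m k net B N x w)
                   \<le> C * complexity_scale d p q m k T\<^sub>1 (Max (N ` {1..d})))) \<and>
      \<comment> \<open>accuracy of order twice the least number of points, as the mesh is refined\<close>
      (\<exists>K::real. \<forall>(N :: nat \<Rightarrow> nat) (s :: nat \<Rightarrow> nat) (t :: nat \<Rightarrow> nat \<Rightarrow> real)
           (x :: nat \<Rightarrow> nat \<Rightarrow> real) (w :: nat \<Rightarrow> nat \<Rightarrow> real) (h::real) (M::real).
         let Nmin = Min (N ` {1..d});
             F = integrand d p q m k net B;
             U = box_of d (\<lambda>i. interior (\<Omega> i))
         in (\<forall>i\<in>{1..d}. N i \<ge> 1 \<and>
               composite_gauss_rule (Inf (\<Omega> i)) (Sup (\<Omega> i)) h (s i) (t i) (N i) (x i) (w i)) \<and>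
            C_bounded d U (2 * Nmin) F \<and>
            (\<forall>\<gamma>. (\<Sum>i=1..d. \<gamma> i) = 2 * Nmin \<longrightarrow> (\<forall>y\<in>U. \<bar>multi_deriv d \<gamma> F y\<bar> \<le> M)) \<longrightarrow>
            \<bar>splitting_scheme d p q m k net B (\<lambda>i. s i * N i) x w
                - (LINT y:box_of d \<Omega>|lebesgue_pow d. F y)\<bar>
              \<le> K * M * (h ^ (2 * Nmin) / fact (2 * Nmin)))) \<and>
    \<comment> \<open>the complexity bound is polynomial in the dimension\<close>
    (\<forall>p q m k T\<^sub>1 N. \<exists>P :: real poly. \<forall>d. complexity_scale d p q m k T\<^sub>1 N = poly P (real d))"
proof (rule conjI, rule exI[of _ "160 :: real"], goal_cases)
  case 1
  show ?case
  proof (intro allI impI conjI, goal_cases)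
    case (1 d p q m k \<Omega> net B N x w)
    then show ?case
      by (intro splitting_eq_direct) blast
  next
    case (2 d p q m k \<Omega> net B N x w)
    show ?case
      by (rule prog_val_splitting_prog)
  next
    case (3 d p q m k \<Omega> net B N x w T)
    then show ?case
      by (intro prog_cost_splitting_prog_le) blast+
  next
    case (4 d p q m k \<Omega> net B)
    show ?case
      unfolding Let_def
    proof (intro exI[of _ "2 * real d * (\<Prod>i=1..d. Sup (\<Omega> i) - Inf (\<Omega> i))"] allI impI, goal_cases)
      case (1 N s t x w h M)
      from 4 have "d \<ge> 1" "\<forall>i\<in>{1..d}. is_interval (\<Omega> i) \<and> bounded (\<Omega> i) \<and> interior (\<Omega> i) \<noteq> {}"
        "\<forall>i\<in>{1..d}. smooth_subnetwork p m (net i)"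
        by blast+
      then show ?case
        by (rule splitting_scheme_error_le)
          (rule 1 [THEN conjunct1] 1 [THEN conjunct2, THEN conjunct1] 1 [THEN conjunct2, THEN conjunct2])+
    qed
  qed
next
  case 2
  show ?case
    by (intro allI complexity_scale_poly)
qed

end
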